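(* Let $k\ge 2$ and let $F_1,\dots,F_k$ be cumulative distribution functions supported on $[0,1]$ whose densities $f_1,\dots,f_k$ are well defined and Lipschitz continuous with constant $L>0$, i.e. $$|f_i(x)-f_i(y)|\le L\,|x-y|\qquad\text{for all }x,y\in[0,1],\ i\in[k].$$ Let $\{(Y_j,Z_j)\}_{j=1}^n$ be $n$ i.i.d. samples from the first-price auction with bid distributions $F_1,\dots,F_k$, and let $\delta\in(0,1)$. Then there exists a polynomial-time estimation algorithm that computes from these samples functions $\hat f_i$, $i\in[k]$, with the following guarantee: for every $p,\gamma\ge0$ such that $\Pr(Y\le p)\ge\gamma$ (where $(Y,Z)$ is a sample from the same auction) and every $\varepsilon\in(0,\gamma/2]$, $$\Pr\left(\int_p^1\big|\hat f_i(x)-f_i(x)\big|\,dx\le\varepsilon\right)\ \ge\ 1-\delta\qquad\text{for all } i\in[k],$$ assuming that $$n=\tilde\Theta\left(\frac{L^2\,\log(k/\delta)}{\gamma^4\,\varepsilon^4}\right).$$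
   Context: Notation: $[k]=\{1,\dots,k\}$. A cumulative distribution function (CDF) $F$ is supported on $[0,1]$ if $F(x)=0$ for all $x<0$ and $F(1)=1$. First-price auction data: a sample $(Y,Z)$ from the first-price auction with bid distributions $F_1,\dots,F_k$ is generated by drawing $X_i\sim F_i$ independently for $i\in[k]$ and observing $(Y,Z)=(\max_{i\in[k]}X_i,\ \arg\max_{i\in[k]}X_i)$. The number $k$ of bidders is known. Order notation: constants hidden in $O,\Theta$ are absolute (independent of the distributions and of all parameters). The phrase "assuming $n=\tilde\Theta(f)$" means that there are absolute constants $C$ and $c\ge 1$ such that $n=C f\log^{c} f$ samples suffice for the conclusion. "Polynomial time" means polynomial in the number $n$ of samples. *)

theory Defs
  imports "HOL-Probability.Probability" "HOL-Computational_Algebra.Polynomial"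
begin

section \<open>The first-price auction\<close>

definition unit_cdf :: "(real \<Rightarrow> real) \<Rightarrow> bool" where
  "unit_cdf F \<longleftrightarrow>
     mono F \<and> (\<forall>x. continuous (at_right x) F) \<and> (F \<longlongrightarrow> 0) at_bot \<and> (F \<longlongrightarrow> 1) at_top \<and>
     (\<forall>x<0. F x = 0) \<and> F 1 = 1"

text \<open>The values of \<open>f\<close> outside the unit interval are irrelevant. Nonnegativity has to be required
  because \<^const>\<open>ennreal\<close> truncates negative values to zero.\<close>

definition has_unit_density :: "(real \<Rightarrow> real) \<Rightarrow> (real \<Rightarrow> real) \<Rightarrow> bool" where
  "has_unit_density F f \<longleftrightarrow>
     (\<forall>x\<in>{0..1}. 0 \<le> f x) \<and> (\<lambda>x. f x * indicator {0..1} x) \<in> borel_measurable borel \<and>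
     interval_measure F = density lborel (\<lambda>x. ennreal (f x * indicator {0..1} x))"

definition bids :: "nat \<Rightarrow> (nat \<Rightarrow> real \<Rightarrow> real) \<Rightarrow> (nat \<Rightarrow> real) measure" where
  "bids k F = PiM {1..k} (\<lambda>i. interval_measure (F i))"

text \<open>The highest bid and a bidder who submitted it. Ties have probability zero when the bids have
  densities; \<^const>\<open>arg_max_on\<close> breaks them in some fixed way that depends only on the set of
  highest bidders.\<close>

definition auction_outcome :: "nat \<Rightarrow> (nat \<Rightarrow> real) \<Rightarrow> real \<times> nat" where
  "auction_outcome k X = (Max (X ` {1..k}), arg_max_on X {1..k})"

definition first_price :: "nat \<Rightarrow> (nat \<Rightarrow> real \<Rightarrow> real) \<Rightarrow> (real \<times> nat) measure" where
  "first_price k F = distr (bids k F) (borel \<Otimes>\<^sub>M count_space UNIV) (auction_outcome k)"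

definition first_price_samples ::
  "nat \<Rightarrow> nat \<Rightarrow> (nat \<Rightarrow> real \<Rightarrow> real) \<Rightarrow> (nat \<Rightarrow> real \<times> nat) measure" where
  "first_price_samples n k F = PiM {..<n} (\<lambda>_. first_price k F)"


lemma auction_outcome_measurable:
  assumes "1 \<le> k"
  shows "auction_outcome k \<in> measurable (PiM {1..k} (\<lambda>_. borel)) (borel \<Otimes>\<^sub>M count_space UNIV)"
proof -
  let ?M = "PiM {1..k} (\<lambda>_. borel :: real measure)"
  let ?T = "\<lambda>X::nat\<Rightarrow>real. {i\<in>{1..k}. \<forall>j\<in>{1..k}. X j \<le> X i}"
  have a: "arg_max_on X {1..k} = (SOME i. i \<in> ?T X)" for X :: "nat \<Rightarrow> real"
    unfolding arg_max_on_def arg_max_def is_arg_max_def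
    by (rule arg_cong[where f=Eps]) (auto simp: fun_eq_iff not_less)
  have T: "?T \<in> measurable ?M (count_space (Pow {1..k}))"
  proof (rule measurable_count_space_eq2[THEN iffD2], simp, safe)
    fix A assume "A \<subseteq> {1..k}"
    have "?T -` {A} \<inter> space ?M = {X\<in>space ?M. \<forall>i\<in>{1..k}. (i \<in> A) = (\<forall>j\<in>{1..k}. X j \<le> X i)}"
      using \<open>A \<subseteq> {1..k}\<close> by (auto simp: set_eq_iff)
    also have "\<dots> \<in> sets ?M"
    proof -
      have [measurable]: "Measurable.pred ?M (\<lambda>X. X j \<le> X i)" if "i \<in> {1..k}" "j \<in> {1..k}" for i j
        using that unfolding not_less[symmetric]
        by (intro pred_intros_logic borel_measurable_pred_less measurable_component_singleton)
      show ?thesis by measurable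
    qed
    finally show "?T -` {A} \<inter> space ?M \<in> sets ?M" .
  qed
  have am: "(\<lambda>X. arg_max_on X {1..k}) \<in> measurable ?M (count_space UNIV)"
    unfolding a by (rule measurable_compose[OF T]) simp
  have "(\<lambda>X. Max ((\<lambda>i. X i) ` {1..k})) \<in> borel_measurable ?M"
    using assms by (intro borel_measurable_Max) auto
  then have mx: "(\<lambda>X. Max (X ` {1..k})) \<in> borel_measurable ?M" by simp
  show ?thesis unfolding auction_outcome_def using am mx by measurable
qed
lemma prob_space_first_price:
  assumes "1 \<le> k" and F: "\<And>i. i \<in> {1..k} \<Longrightarrow> unit_cdf (F i)"
  shows "prob_space (first_price k F)"
proof -
  have "prob_space (bids k F)" unfolding bids_def
    using F by (intro prob_space_PiM real_distribution.axioms(1) real_distribution_interval_measure)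
      (auto simp: unit_cdf_def mono_def)
  moreover have "auction_outcome k \<in> measurable (bids k F) (borel \<Otimes>\<^sub>M count_space UNIV)"
  proof -
    have "sets (bids k F) = sets (PiM {1..k} (\<lambda>_. borel))"
      unfolding bids_def by (intro sets_PiM_cong) auto
    then show ?thesis
      using auction_outcome_measurable[OF assms(1)] measurable_cong_sets by blast
  qed
  ultimately show ?thesis unfolding first_price_def by (rule prob_space.prob_space_distr)
qed


section \<open>A real random access machine\<close>

text \<open>Polynomial time is measured on a unit-cost real RAM, given here as a small imperative language.
  The memory consists of arrays of natural numbers and arrays of reals, addressed by the name of
  the array and an index. The operations on reals are the field operations and comparison. There is
  no rounding operation, and the only constants are natural numbers, so that no information can be
  hidden in a program. Natural numbers can only be added and subtracted: multiplication at unit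
  cost would allow values whose length is exponential in the running time.
  A program contains only finitely many expressions, so charging one unit per command instead
  of one per arithmetic operation changes the running time by at most a constant factor.\<close>

type_synonym memory = "(nat \<Rightarrow> nat \<Rightarrow> nat) \<times> (nat \<Rightarrow> nat \<Rightarrow> real)"

datatype nexp =
    NConst nat
  | NGet nat nexp
  | NPlus nexp nexp
  | NMinus nexp nexp

datatype rexp =
    RGet nat nexp
  | ROfNat nexp
  | RPlus rexp rexp
  | RMinus rexp rexp
  | RTimes rexp rexp
  | RDivide rexp rexp

datatype bexp =
    NLess nexp nexp
  | RLess rexp rexp
  | BNot bexp
  | BAnd bexp bexp

datatype com =
    Skip
  | NAssign nat nexp nexp
  | RAssign nat nexp rexp
  | Seq com com
  | Cond bexp com com
  | While bexp com

fun nval :: "nexp \<Rightarrow> memory \<Rightarrow> nat" where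
  "nval (NConst m) s = m"
| "nval (NGet a e) s = fst s a (nval e s)"
| "nval (NPlus e e') s = nval e s + nval e' s"
| "nval (NMinus e e') s = nval e s - nval e' s"

fun rval :: "rexp \<Rightarrow> memory \<Rightarrow> real" where
  "rval (RGet a e) s = snd s a (nval e s)"
| "rval (ROfNat e) s = real (nval e s)"
| "rval (RPlus e e') s = rval e s + rval e' s"
| "rval (RMinus e e') s = rval e s - rval e' s"
| "rval (RTimes e e') s = rval e s * rval e' s"
| "rval (RDivide e e') s = rval e s / rval e' s"

fun bval :: "bexp \<Rightarrow> memory \<Rightarrow> bool" where
  "bval (NLess e e') s \<longleftrightarrow> nval e s < nval e' s"
| "bval (RLess e e') s \<longleftrightarrow> rval e s < rval e' s"
| "bval (BNot b) s \<longleftrightarrow> \<not> bval b s"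
| "bval (BAnd b b') s \<longleftrightarrow> bval b s \<and> bval b' s"

fun nstore :: "nat \<Rightarrow> nat \<Rightarrow> nat \<Rightarrow> memory \<Rightarrow> memory" where
  "nstore a j v (N, R) = (N(a := (N a)(j := v)), R)"

fun rstore :: "nat \<Rightarrow> nat \<Rightarrow> real \<Rightarrow> memory \<Rightarrow> memory" where
  "rstore a j v (N, R) = (N, R(a := (R a)(j := v)))"

text \<open>\<open>exec c s t s'\<close>: started in memory \<open>s\<close>, the program \<open>c\<close> halts after \<open>t\<close> steps in memory \<open>s'\<close>.\<close>

inductive exec :: "com \<Rightarrow> memory \<Rightarrow> nat \<Rightarrow> memory \<Rightarrow> bool" where
  Skip: "exec Skip s 1 s"
| NAssign: "exec (NAssign a e e') s 1 (nstore a (nval e s) (nval e' s) s)"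
| RAssign: "exec (RAssign a e e') s 1 (rstore a (nval e s) (rval e' s) s)"
| Seq: "exec c1 s t1 s' \<Longrightarrow> exec c2 s' t2 s'' \<Longrightarrow> exec (Seq c1 c2) s (t1 + t2) s''"
| CondTrue: "bval b s \<Longrightarrow> exec c1 s t s' \<Longrightarrow> exec (Cond b c1 c2) s (Suc t) s'"
| CondFalse: "\<not> bval b s \<Longrightarrow> exec c2 s t s' \<Longrightarrow> exec (Cond b c1 c2) s (Suc t) s'"
| WhileFalse: "\<not> bval b s \<Longrightarrow> exec (While b c) s 1 s"
| WhileTrue: "bval b s \<Longrightarrow> exec c s t1 s' \<Longrightarrow> exec (While b c) s' t2 s'' \<Longrightarrow>
    exec (While b c) s (Suc (t1 + t2)) s''"

inductive_cases exec_SkipE: "exec Skip s t s'"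
inductive_cases exec_NAssignE: "exec (NAssign a e e') s t s'"
inductive_cases exec_RAssignE: "exec (RAssign a e e') s t s'"
inductive_cases exec_SeqE: "exec (Seq c1 c2) s t s'"
inductive_cases exec_CondE: "exec (Cond b c1 c2) s t s'"
inductive_cases exec_WhileE: "exec (While b c) s t s'"

lemma exec_deterministic:
  "exec c s t s' \<Longrightarrow> exec c s u s'' \<Longrightarrow> u = t \<and> s'' = s'"
proof (induction arbitrary: u s'' rule: exec.induct)
  case (Seq c1 s t1 s' c2 t2 s2)
  from Seq.prems show ?case by (rule exec_SeqE) (use Seq.IH in blast)
next
  case (CondTrue b s c1 t s' c2)
  from CondTrue.prems show ?case by (rule exec_CondE) (use CondTrue in blast)+
next
  case (CondFalse b s c2 t s' c1)
  from CondFalse.prems show ?case by (rule exec_CondE) (use CondFalse in blast)+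
next
  case (WhileTrue b s c t1 s' t2 s2)
  from WhileTrue.prems show ?case
    by (rule exec_WhileE) (use WhileTrue.IH WhileTrue.hyps in blast)+
qed (auto elim: exec_SkipE exec_NAssignE exec_RAssignE exec_WhileE)


section \<open>Polynomial-time estimators\<close>

text \<open>The argument list of an estimator: the number \<open>k\<close> of bidders, the Lipschitz constant \<open>L\<close>, the
  confidence parameter \<open>\<delta>\<close>, the number \<open>n\<close> of samples, the samples, a bidder \<open>i\<close> and a point \<open>x\<close>.
  The value is the estimate of \<open>f\<^sub>i x\<close>.\<close>

type_synonym estimator =
  "nat \<Rightarrow> real \<Rightarrow> real \<Rightarrow> nat \<Rightarrow> (nat \<Rightarrow> real \<times> nat) \<Rightarrow> nat \<Rightarrow> real \<Rightarrow> real"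

definition load ::
  "nat \<Rightarrow> real \<Rightarrow> real \<Rightarrow> nat \<Rightarrow> (nat \<Rightarrow> real \<times> nat) \<Rightarrow> nat \<Rightarrow> real \<Rightarrow> memory" where
  "load k L \<delta> n S i x =
     ((\<lambda>_ _. 0)(0 := (\<lambda>_. 0)(0 := n, 1 := k, 2 := i),
                1 := (\<lambda>j. if j < n then snd (S j) else 0)),
      (\<lambda>_ _. 0)(0 := (\<lambda>_. 0)(0 := L, 1 := \<delta>, 2 := x),
                1 := (\<lambda>j. if j < n then fst (S j) else 0)))"

definition result :: "memory \<Rightarrow> real" where
  "result s = snd s 2 0"

text \<open>To compute the estimated functions means to evaluate them, at any given bidder and point, from
  the samples. The number of bidders is not bounded by a polynomial in the number \<open>n\<close> of samples, so
  the functions cannot be listed one by one in time polynomial in \<open>n\<close>. One program serves all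
  values of the parameters, and one polynomial in \<open>n\<close> alone bounds its running time.\<close>

definition computes_in_poly_time :: "com \<Rightarrow> estimator \<Rightarrow> bool" where
  "computes_in_poly_time prog fhat \<longleftrightarrow>
     (\<exists>q :: nat poly. \<forall>k L \<delta> n S i x.
        2 \<le> k \<longrightarrow> 0 < L \<longrightarrow> 0 < \<delta> \<longrightarrow> \<delta> < 1 \<longrightarrow>
        (\<forall>j<n. fst (S j) \<in> {0..1} \<and> snd (S j) \<in> {1..k}) \<longrightarrow>
        i \<in> {1..k} \<longrightarrow> x \<in> {0..1} \<longrightarrow>
        (\<exists>t s. exec prog (load k L \<delta> n S i x) t s \<and> t \<le> poly q n \<and>
               result s = fhat k L \<delta> n S i x))"

text \<open>Integrability is part of the event because the Bochner integral of a non-integrable function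
  is zero.\<close>

definition tail_L1_close :: "real \<Rightarrow> real \<Rightarrow> (real \<Rightarrow> real) \<Rightarrow> (real \<Rightarrow> real) \<Rightarrow> bool" where
  "tail_L1_close p \<epsilon> g f \<longleftrightarrow>
     set_integrable lborel {p..1} (\<lambda>x. \<bar>g x - f x\<bar>) \<and> (LBINT x:{p..1}. \<bar>g x - f x\<bar>) \<le> \<epsilon>"

end

theory Submission
  imports Defs
begin

text \<open>Write \<open>H = F\<^sub>1 \<cdots> F\<^sub>k\<close> for the distribution function of the highest bid. The sub-distribution of
  the bids won by \<open>i\<close> has density \<open>f\<^sub>i H / F\<^sub>i\<close>, so that the expectation of \<open>1 / H(Y)\<close> on the event
  \<open>Z = i, Y > x\<close> is \<open>- ln (F\<^sub>i x)\<close>. Replacing \<open>n H(Y\<^sub>j)\<close> by the rank of \<open>Y\<^sub>j\<close> and the exponential by a product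
  gives the product-limit (Kaplan-Meier) estimator of \<open>F\<^sub>i\<close>, which needs field operations only. Hoeffding's
  inequality at the \<open>m/n\<close>-quantiles of \<open>H\<close>, together with monotonicity, bounds its error at every \<open>x\<close> by
  \<open>O(\<alpha> / H(x)\<^sup>2)\<close>, where \<open>\<alpha>\<close> is of order \<open>sqrt (ln (n/\<delta>) / n)\<close>.

  The density is estimated by a difference quotient. The estimator knows neither \<open>p\<close> nor \<open>\<gamma>\<close> nor \<open>\<epsilon>\<close>, so
  it uses the local step \<open>h = b / H(x)\<close>, estimated from the rank of \<open>x\<close>, with \<open>b = sqrt (\<alpha> / L)\<close>. Stochastic
  error and bias are then both of order \<open>L b / H(x)\<close>. Where \<open>x + h\<close> exceeds \<open>1\<close>, the estimate is the
  constant \<open>1\<close>, which is off by at most \<open>L\<close> because every \<open>f\<^sub>i\<close> attains its mean \<open>1\<close>; that region has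
  length at most \<open>h\<close>, so it contributes \<open>O(L b / \<gamma>)\<close> as well.\<close>

section \<open>Lipschitz densities\<close>

locale lipschitz_auction =
  fixes k :: nat and F f :: "nat \<Rightarrow> real \<Rightarrow> real" and L :: real
  assumes two_le_k: "2 \<le> k"
    and cdf: "i \<in> {1..k} \<Longrightarrow> unit_cdf (F i)"
    and density: "i \<in> {1..k} \<Longrightarrow> has_unit_density (F i) (f i)"
    and L_pos: "0 < L"
    and lipschitz: "i \<in> {1..k} \<Longrightarrow> x \<in> {0..1} \<Longrightarrow> y \<in> {0..1} \<Longrightarrow> \<bar>f i x - f i y\<bar> \<le> L * \<bar>x - y\<bar>"
begin

lemma F_mono: "i \<in> {1..k} \<Longrightarrow> x \<le> y \<Longrightarrow> F i x \<le> F i y"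
  using cdf by (auto simp: unit_cdf_def mono_def)

lemma F_one: "i \<in> {1..k} \<Longrightarrow> 1 \<le> x \<Longrightarrow> F i x = 1"
proof -
  assume i: "i \<in> {1..k}" and x: "1 \<le> x"
  have "F i x \<le> 1"
    using cdf[OF i] F_mono[OF i]
    by (intro tendsto_lowerbound[of "F i" 1 at_top]) (auto simp: unit_cdf_def eventually_at_top_linorder)
  moreover have "F i 1 \<le> F i x" "F i 1 = 1" using F_mono[OF i x] cdf[OF i] by (auto simp: unit_cdf_def)
  ultimately show ?thesis by simp
qed

lemma F_neg: "i \<in> {1..k} \<Longrightarrow> x < 0 \<Longrightarrow> F i x = 0"
  using cdf by (auto simp: unit_cdf_def)

lemma F_nonneg: "i \<in> {1..k} \<Longrightarrow> 0 \<le> F i x"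
  using F_mono[of i "min x (-1)" x] F_neg[of i "min x (-1)"] by simp

lemma F_le_1: "i \<in> {1..k} \<Longrightarrow> F i x \<le> 1"
  using F_mono[of i x "max x 1"] F_one[of i "max x 1"] by simp

lemma f_nonneg: "i \<in> {1..k} \<Longrightarrow> x \<in> {0..1} \<Longrightarrow> 0 \<le> f i x"
  using density by (auto simp: has_unit_density_def)

lemma f_measurable [measurable]:
  "i \<in> {1..k} \<Longrightarrow> (\<lambda>x. f i x * indicator {0..1} x) \<in> borel_measurable borel"
  using density by (auto simp: has_unit_density_def)

lemma f_continuous: "i \<in> {1..k} \<Longrightarrow> continuous_on {0..1} (f i)"
  unfolding continuous_on_iff
proof (intro ballI allI impI)
  fix x e :: real assume i: "i \<in> {1..k}" and x: "x \<in> {0..1}" and e: "0 < e"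
  show "\<exists>d>0. \<forall>x'\<in>{0..1}. dist x' x < d \<longrightarrow> dist (f i x') (f i x) < e"
  proof (intro exI[of _ "e / L"] conjI ballI impI)
    fix y assume y: "y \<in> {0..1}" "dist y x < e / L"
    have "\<bar>f i y - f i x\<bar> \<le> L * \<bar>y - x\<bar>" using lipschitz i x y by blast
    also have "\<dots> < e" using y L_pos by (simp add: dist_real_def field_simps)
    finally show "dist (f i y) (f i x) < e" by (simp add: dist_real_def)
  qed (use e L_pos in auto)
qed

lemma emeasure_bid: "i \<in> {1..k} \<Longrightarrow> emeasure (interval_measure (F i)) {..x} = ennreal (F i x)"
  using cdf F_mono by (intro emeasure_interval_measure_Iic) (auto simp: unit_cdf_def)

lemma interval_measure_density:
  "i \<in> {1..k} \<Longrightarrow> interval_measure (F i) = density lborel (\<lambda>x. ennreal (f i x * indicator {0..1} x))"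
  using density by (simp add: has_unit_density_def)

text \<open>The density is given as an identity of measures, hence of nonnegative Lebesgue
  integrals. Continuity of \<open>f i\<close> provides a gauge integral as well; identifying the two
  on a half line opens the way to the fundamental theorem of calculus.\<close>

lemma F_eq_integral:
  assumes i: "i \<in> {1..k}" and x: "x \<in> {0..1}"
  shows "(f i has_integral F i x) {0..x}"
proof -
  have int: "f i integrable_on {0..x}"
    using x by (intro integrable_continuous_interval continuous_on_subset[OF f_continuous[OF i]]) auto
  define I where "I = integral {0..x} (f i)"
  have I: "(f i has_integral I) {0..x}" using int by (simp add: I_def has_integral_integral)
  have I0: "0 \<le> I" using f_nonneg[OF i] x by (intro has_integral_nonneg[OF I]) auto
  have eq: "(f i y * indicator {0..1} y) * indicator {..x} y = (if y \<in> {0..x} then f i y else 0)" for y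
    using x by (auto simp: indicator_def)
  have "((\<lambda>y. (f i y * indicator {0..1} y) * indicator {..x} y) has_integral I) UNIV"
    unfolding eq using I by (subst has_integral_restrict_UNIV)
  then have "(\<integral>\<^sup>+y. ennreal ((f i y * indicator {0..1} y) * indicator {..x} y) \<partial>lborel) = ennreal I"
    using f_nonneg[OF i] f_measurable[OF i] I0
    by (intro nn_integral_has_integral_lborel) (auto simp: indicator_def intro!: borel_measurable_times)
  then have "ennreal I = (\<integral>\<^sup>+y. ennreal (f i y * indicator {0..1} y) * indicator {..x} y \<partial>lborel)"
    by (subst nn_integral_cong[where v="\<lambda>y. ennreal ((f i y * indicator {0..1} y) * indicator {..x} y)"])
       (auto simp: indicator_def)
  also have "\<dots> = emeasure (interval_measure (F i)) {..x}"
    using f_measurable[OF i] by (subst interval_measure_density[OF i], subst emeasure_density) auto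
  also have "\<dots> = ennreal (F i x)" by (rule emeasure_bid[OF i])
  finally have "I = F i x" using I0 F_nonneg[OF i] by simp
  with I show ?thesis by simp
qed

lemma F_zero: "i \<in> {1..k} \<Longrightarrow> F i 0 = 0"
  using F_eq_integral[of i 0] has_integral_unique[OF has_integral_refl(2)[of "f i" 0], of "F i 0"] by simp

lemma F_deriv:
  assumes i: "i \<in> {1..k}" and x: "x \<in> {0..1}"
  shows "(F i has_real_derivative f i x) (at x within {0..1})"
proof -
  have "((\<lambda>u. integral {0..u} (f i)) has_vector_derivative f i x) (at x within {0..1})"
    using f_continuous[OF i] x by (rule integral_has_vector_derivative)
  moreover have "integral {0..u} (f i) = F i u" if "u \<in> {0..1}" for u
    using F_eq_integral[OF i that] by (rule integral_unique)
  ultimately show ?thesis using x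
    by (metis (no_types, lifting) has_vector_derivative_transform has_real_derivative_iff_has_vector_derivative)
qed

lemma F_mvt:
  assumes i: "i \<in> {1..k}" and "0 \<le> a" "a < b" "b \<le> 1"
  obtains z where "a < z" "z < b" "F i b - F i a = (b - a) * f i z"
proof -
  have "\<exists>z\<in>{a<..<b}. F i b - F i a = (b - a) * f i z"
  proof (rule mvt_simple[OF \<open>a < b\<close>, where f'="\<lambda>x y. y * f i x", simplified])
    fix x assume "a \<le> x" "x \<le> b"
    then have "(F i has_real_derivative f i x) (at x within {a..b})"
      using F_deriv[OF i, of x] assms by (auto elim: DERIV_subset)
    then show "(F i has_derivative (\<lambda>y. y * f i x)) (at x within {a..b})"
      by (simp add: has_field_derivative_def mult_commute_abs)
  qed
  with that show ?thesis by auto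
qed

lemma f_near_1:
  assumes i: "i \<in> {1..k}" and x: "x \<in> {0..1}"
  shows "\<bar>f i x - 1\<bar> \<le> L"
proof -
  obtain z where z: "0 < z" "z < 1" "F i 1 - F i 0 = (1 - 0) * f i z"
    using F_mvt[OF i, of 0 1] by auto
  then have "f i z = 1" using F_zero[OF i] F_one[OF i, of 1] by simp
  then have "\<bar>f i x - 1\<bar> \<le> L * \<bar>x - z\<bar>" using lipschitz[OF i x, of z] z by simp
  also have "\<dots> \<le> L * 1" using x z L_pos by (intro mult_left_mono) auto
  finally show ?thesis by simp
qed

lemma F_difference_quotient:
  assumes i: "i \<in> {1..k}" and "0 \<le> x" "0 < h" "x + h \<le> 1"
  shows "\<bar>(F i (x + h) - F i x) / h - f i x\<bar> \<le> L * h"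
proof -
  obtain z where z: "x < z" "z < x + h" "F i (x + h) - F i x = (x + h - x) * f i z"
    using F_mvt[OF i, of x "x + h"] assms by auto
  then have "(F i (x + h) - F i x) / h = f i z" using assms by simp
  moreover have "\<bar>f i z - f i x\<bar> \<le> L * \<bar>z - x\<bar>" using lipschitz[OF i, of z x] z assms by simp
  moreover have "L * \<bar>z - x\<bar> \<le> L * h" using z L_pos by (intro mult_left_mono) auto
  ultimately show ?thesis by simp
qed

lemma F_continuous: "i \<in> {1..k} \<Longrightarrow> continuous_on {0..1} (F i)"
  using F_deriv by (intro DERIV_continuous_on) auto

text \<open>The integrand is the logarithmic derivative of \<open>F i\<close>, and
  \<open>ln (F i 1) = 0\<close>.\<close>

lemma F_log_integral:
  assumes i: "i \<in> {1..k}" and x: "x \<in> {0..1}" and pos: "0 < F i x"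
  shows "((\<lambda>y. f i y / F i y) has_integral - ln (F i x)) {x..1}"
proof -
  have "((\<lambda>y. f i y / F i y) has_integral ln (F i 1) - ln (F i x)) {x..1}"
  proof (rule fundamental_theorem_of_calculus)
    fix y assume y: "y \<in> {x..1}"
    have "F i y > 0" using F_mono[OF i, of x y] y pos by simp
    then have "((\<lambda>y. ln (F i y)) has_real_derivative 1 / F i y * f i y) (at y within {x..1})"
      using y x by (intro DERIV_ln_divide[THEN DERIV_chain2] DERIV_subset[OF F_deriv[OF i]]) auto
    then show "((\<lambda>y. ln (F i y)) has_vector_derivative f i y / F i y) (at y within {x..1})"
      by (simp add: has_real_derivative_iff_has_vector_derivative)
  qed (use x in auto)
  then show ?thesis using F_one[OF i, of 1] by simp
qed

end


section \<open>The law of the highest bid and its bidder\<close>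

lemma arg_max_on_in:
  fixes X :: "'a \<Rightarrow> 'b :: linorder"
  assumes "finite S" "S \<noteq> {}"
  shows "arg_max_on X S \<in> S" and "\<And>j. j \<in> S \<Longrightarrow> X j \<le> X (arg_max_on X S)"
proof -
  have "Max (X ` S) \<in> X ` S" using assms by (intro Max_in) auto
  then obtain i where "i \<in> S" "X i = Max (X ` S)" by auto
  moreover have "X j \<le> Max (X ` S)" if "j \<in> S" for j using assms that by (intro Max_ge) auto
  ultimately have "is_arg_max X (\<lambda>x. x \<in> S) i" by (auto simp: is_arg_max_def not_less)
  then have "is_arg_max X (\<lambda>x. x \<in> S) (arg_max_on X S)"
    unfolding arg_max_on_def arg_max_def by (rule someI)
  then show "arg_max_on X S \<in> S" "\<And>j. j \<in> S \<Longrightarrow> X j \<le> X (arg_max_on X S)"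
    by (auto simp: is_arg_max_def not_less)
qed

context lipschitz_auction
begin

definition H :: "real \<Rightarrow> real" where
  "H x = (\<Prod>j\<in>{1..k}. F j x)"

text \<open>The library's finite product measures want a probability space at every index, hence the junk
  value outside \<open>{1..k}\<close>.\<close>

definition bid :: "nat \<Rightarrow> real measure" where
  "bid j = interval_measure (F (if j \<in> {1..k} then j else 1))"

lemma clamp_in: "(if j \<in> {1..k} then j else 1) \<in> {1..k}"
  using two_le_k by auto

lemma prob_space_bid: "prob_space (bid j)"
proof -
  have "unit_cdf (F (if j \<in> {1..k} then j else 1))" using cdf[OF clamp_in] .
  then show ?thesis unfolding bid_def
    by (intro real_distribution.axioms(1) real_distribution_interval_measure)
       (auto simp: unit_cdf_def mono_def)
qed

lemma sets_bid [measurable_cong, simp]: "sets (bid j) = sets borel"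
  by (simp add: bid_def)

lemma space_bid [simp]: "space (bid j) = UNIV"
  by (simp add: bid_def)

lemma bids_eq: "bids k F = PiM {1..k} bid"
  unfolding bids_def by (rule PiM_cong) (auto simp: bid_def)

lemma emeasure_bid_atMost: "i \<in> {1..k} \<Longrightarrow> emeasure (bid i) {..x} = ennreal (F i x)"
  using emeasure_bid[of i x] by (simp add: bid_def)

text \<open>A law with a density has no atoms. Having the same value for the open and the closed
  half line is what makes ties negligible in \<open>nn_integral_won\<close>.\<close>

lemma emeasure_bid_lessThan:
  assumes i: "i \<in> {1..k}"
  shows "emeasure (bid i) {..<x} = ennreal (F i x)"
proof -
  have "emeasure (interval_measure (F i)) {x} = 0"
    unfolding interval_measure_density[OF i]
    by (subst emeasure_density)
       (use f_measurable[OF i] in \<open>auto intro!: nn_integral_null_set\<close>)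
  then have "emeasure (interval_measure (F i)) ({..<x} \<union> {x}) = emeasure (interval_measure (F i)) {..<x}"
    by (intro emeasure_Un_null_set) (auto simp: null_sets_def)
  moreover have "{..<x} \<union> {x} = {..x}" by auto
  ultimately have "emeasure (interval_measure (F i)) {..x} = emeasure (interval_measure (F i)) {..<x}"
    by metis
  with emeasure_bid_atMost[OF i, of x] i show ?thesis by (simp add: bid_def)
qed

sublocale bid: product_prob_space bid
  by (rule product_prob_spaceI) (rule prob_space_bid)

lemma outcome_measurable [measurable]:
  "auction_outcome k \<in> measurable (PiM {1..k} bid) (borel \<Otimes>\<^sub>M count_space UNIV)"
proof -
  have "sets (PiM {1..k} bid) = sets (PiM {1..k} (\<lambda>_. borel))" by (intro sets_PiM_cong) auto
  then show ?thesis using auction_outcome_measurable[of k] two_le_k measurable_cong_sets by force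
qed

lemma sets_first_price [measurable_cong, simp]:
  "sets (first_price k F) = sets (borel \<Otimes>\<^sub>M count_space UNIV)"
  by (simp add: first_price_def)

lemma space_first_price [simp]: "space (first_price k F) = UNIV"
  using sets_eq_imp_space_eq[OF sets_first_price] by (simp add: space_pair_measure)

text \<open>The event that \<open>i\<close> is declared the winner lies between "all others bid
  strictly less" and "all others bid at most as much". Both bounds give the same integral, so the
  tie-breaking rule inside \<open>arg_max_on\<close> never has to be analysed.\<close>

lemma nn_integral_won:
  fixes g :: "real \<Rightarrow> ennreal"
  assumes i: "i \<in> {1..k}" and g [measurable]: "g \<in> borel_measurable borel"
  shows "(\<integral>\<^sup>+w. g (fst w) * indicator {i} (snd w) \<partial>first_price k F) =
    (\<integral>\<^sup>+t. g t * (\<Prod>j\<in>{1..k} - {i}. ennreal (F j t)) \<partial>bid i)"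
proof -
  define J where "J = {1..k} - {i}"
  have J: "finite J" "i \<notin> J" "insert i J = {1..k}" "J \<subseteq> {1..k}" using i by (auto simp: J_def)
  \<comment> \<open>Given the bid \<open>t\<close> of \<open>i\<close>, the other bids are
    independent and contribute one factor \<open>F j t\<close> each. The comparison \<open>P\<close>
    is left abstract so that one computation covers both \<le> and <.\<close>
  have fubini: "(\<integral>\<^sup>+X. g (X i) * indicator {X. \<forall>j\<in>J. P (X j) (X i)} X \<partial>bids k F) =
      (\<integral>\<^sup>+t. g t * (\<Prod>j\<in>J. ennreal (F j t)) \<partial>bid i)"
    if P: "\<And>j t. j \<in> J \<Longrightarrow> {x. P x t} \<in> sets borel \<and> emeasure (bid j) {x. P x t} = ennreal (F j t)"
      and meas [measurable]: "Measurable.pred (borel \<Otimes>\<^sub>M borel) (\<lambda>z. P (fst z) (snd z))"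
    for P :: "real \<Rightarrow> real \<Rightarrow> bool"
  proof -
    have coord: "(\<lambda>X. X j) \<in> borel_measurable (PiM (insert i J) bid)" if "j \<in> insert i J" for j
      using measurable_component_singleton[OF that, of bid] measurable_cong_sets[OF refl sets_bid] by blast
    have "Measurable.pred (PiM (insert i J) bid) (\<lambda>X. P (X j) (X i))" if "j \<in> J" for j
      using measurable_compose[OF measurable_Pair[OF coord coord] meas, of j i] that by simp
    then have "Measurable.pred (PiM (insert i J) bid) (\<lambda>X. \<forall>j\<in>J. P (X j) (X i))"
      using J(1) by (intro pred_intros_finite) auto
    then have meas2: "(\<lambda>X. g (X i) * indicator {X. \<forall>j\<in>J. P (X j) (X i)} X) \<in> borel_measurable (PiM (insert i J) bid)"
      using measurable_compose[OF coord g, of i]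
      by (intro borel_measurable_times_ennreal borel_measurable_indicator') (auto simp: pred_def)
    have "(\<integral>\<^sup>+X. g (X i) * indicator {X. \<forall>j\<in>J. P (X j) (X i)} X \<partial>bids k F) =
       (\<integral>\<^sup>+t. \<integral>\<^sup>+X. g ((X(i := t)) i) * indicator {X. \<forall>j\<in>J. P (X j) (X i)} (X(i := t)) \<partial>PiM J bid \<partial>bid i)"
      unfolding bids_eq J(3)[symmetric] using J meas2 by (intro bid.product_nn_integral_insert_rev) auto
    also have "\<dots> = (\<integral>\<^sup>+t. \<integral>\<^sup>+X. g t * indicator (PiE J (\<lambda>j. {x. P x t})) X \<partial>PiM J bid \<partial>bid i)"
      using J(2) by (intro nn_integral_cong arg_cong2[where f="(*)"])
        (auto simp: indicator_def space_PiM PiE_iff)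
    also have "\<dots> = (\<integral>\<^sup>+t. g t * emeasure (PiM J bid) (PiE J (\<lambda>j. {x. P x t})) \<partial>bid i)"
      using P J(1) by (intro nn_integral_cong nn_integral_cmult_indicator sets_PiM_I_finite) auto
    also have "\<dots> = (\<integral>\<^sup>+t. g t * (\<Prod>j\<in>J. ennreal (F j t)) \<partial>bid i)"
      using P J(1) by (intro nn_integral_cong) (simp add: bid.emeasure_PiM)
    finally show ?thesis .
  qed
  have Max: "Max (X ` {1..k}) = X i" if "\<forall>j\<in>J. X j \<le> X i" for X :: "nat \<Rightarrow> real"
    using that i J by (intro Max_eqI) (auto simp: J_def)
  have am: "arg_max_on X {1..k} \<in> {1..k}" "j \<in> {1..k} \<Longrightarrow> X j \<le> X (arg_max_on X {1..k})"
    for X :: "nat \<Rightarrow> real" and j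
    using arg_max_on_in[of "{1..k}", where X = X] i by auto
  let ?I = "\<lambda>X. g (fst (auction_outcome k X)) * indicator {i} (snd (auction_outcome k X))"
  have lhs: "(\<integral>\<^sup>+w. g (fst w) * indicator {i} (snd w) \<partial>first_price k F) = (\<integral>\<^sup>+X. ?I X \<partial>bids k F)"
    unfolding first_price_def bids_eq
  proof (rule nn_integral_distr)
    have "(\<lambda>w. g (fst w) * indicator {i} (snd w)) \<in> borel_measurable (borel \<Otimes>\<^sub>M count_space (UNIV :: nat set))"
      by (intro borel_measurable_times_ennreal measurable_compose[OF measurable_fst g]
            measurable_compose[OF measurable_snd, of "indicator {i}"]) simp
    then show "(\<lambda>w. g (fst w) * indicator {i} (snd w)) \<in>
        borel_measurable (distr (PiM {1..k} bid) (borel \<Otimes>\<^sub>M count_space (UNIV :: nat set)) (auction_outcome k))"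
      by simp
  qed (rule outcome_measurable)
  have upper: "(\<integral>\<^sup>+X. ?I X \<partial>bids k F) \<le> (\<integral>\<^sup>+X. g (X i) * indicator {X. \<forall>j\<in>J. X j \<le> X i} X \<partial>bids k F)"
  proof (intro nn_integral_mono)
    fix X :: "nat \<Rightarrow> real"
    show "?I X \<le> g (X i) * indicator {X. \<forall>j\<in>J. X j \<le> X i} X"
    proof (cases "arg_max_on X {1..k} = i")
      case True
      then have "\<forall>j\<in>J. X j \<le> X i" using am(2)[of _ X] J by auto
      then show ?thesis using Max[of X] by (simp add: auction_outcome_def indicator_def)
    qed (simp add: auction_outcome_def)
  qed
  have lower: "(\<integral>\<^sup>+X. g (X i) * indicator {X. \<forall>j\<in>J. X j < X i} X \<partial>bids k F) \<le> (\<integral>\<^sup>+X. ?I X \<partial>bids k F)"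
  proof (intro nn_integral_mono)
    fix X :: "nat \<Rightarrow> real"
    show "g (X i) * indicator {X. \<forall>j\<in>J. X j < X i} X \<le> ?I X"
    proof (cases "\<forall>j\<in>J. X j < X i")
      case True
      have "X i \<le> X (arg_max_on X {1..k})" "arg_max_on X {1..k} \<in> {1..k}"
        using am(1)[of X] am(2)[of i X] i by auto
      then have "arg_max_on X {1..k} = i" using True J by (metis insertE not_less)
      moreover have "Max (X ` {1..k}) = X i" using True Max[of X] by (simp add: less_imp_le)
      ultimately show ?thesis using True by (simp add: auction_outcome_def)
    qed simp
  qed
  have "(\<integral>\<^sup>+X. g (X i) * indicator {X. \<forall>j\<in>J. X j \<le> X i} X \<partial>bids k F) =
      (\<integral>\<^sup>+t. g t * (\<Prod>j\<in>J. ennreal (F j t)) \<partial>bid i)"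
    using emeasure_bid_atMost J by (intro fubini) (auto simp: atMost_def[symmetric])
  moreover have "(\<integral>\<^sup>+X. g (X i) * indicator {X. \<forall>j\<in>J. X j < X i} X \<partial>bids k F) =
      (\<integral>\<^sup>+t. g t * (\<Prod>j\<in>J. ennreal (F j t)) \<partial>bid i)"
    using emeasure_bid_lessThan J by (intro fubini) (auto simp: lessThan_def[symmetric])
  ultimately show ?thesis using upper lower unfolding lhs J_def by simp
qed

lemma measure_highest_bid: "measure (first_price k F) {w. fst w \<le> x} = H x"
proof -
  have "emeasure (first_price k F) {w. fst w \<le> x} =
      emeasure (bids k F) (auction_outcome k -` {w. fst w \<le> x} \<inter> space (bids k F))"
    unfolding first_price_def bids_eq
  proof (rule emeasure_distr)
    have "{w \<in> space (borel \<Otimes>\<^sub>M count_space UNIV). fst w \<le> x} \<in> sets (borel \<Otimes>\<^sub>M count_space (UNIV :: nat set))"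
      by measurable
    then show "{w. fst w \<le> x} \<in> sets (borel \<Otimes>\<^sub>M count_space (UNIV :: nat set))"
      by (simp add: space_pair_measure)
  qed measurable
  also have "auction_outcome k -` {w. fst w \<le> x} \<inter> space (bids k F) = PiE {1..k} (\<lambda>_. {..x})"
    using two_le_k by (auto simp: auction_outcome_def bids_eq space_PiM PiE_iff)
  also have "emeasure (bids k F) \<dots> = (\<Prod>j\<in>{1..k}. ennreal (F j x))"
    unfolding bids_eq using emeasure_bid_atMost by (subst bid.emeasure_PiM) auto
  also have "\<dots> = ennreal (H x)" unfolding H_def using F_nonneg by (intro prod_ennreal) auto
  finally show ?thesis unfolding measure_def H_def
    using F_nonneg by (simp only: enn2real_ennreal prod_nonneg)
qed

section \<open>Properties of the distribution function of the highest bid\<close>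

lemma H_mono: "x \<le> y \<Longrightarrow> H x \<le> H y"
  unfolding H_def using F_mono F_nonneg by (intro prod_mono) auto

lemma H_nonneg: "0 \<le> H x"
  unfolding H_def using F_nonneg by (intro prod_nonneg) auto

lemma H_le_1: "H x \<le> 1"
  unfolding H_def using F_nonneg F_le_1 by (intro prod_le_1) auto

lemma H_one: "1 \<le> x \<Longrightarrow> H x = 1"
  unfolding H_def using F_one by simp

lemma H_zero: "H 0 = 0"
  unfolding H_def using F_zero[of 1] two_le_k by (intro prod_zero) (auto intro!: bexI[of _ 1])

lemma H_split: "i \<in> {1..k} \<Longrightarrow> H x = F i x * (\<Prod>j\<in>{1..k} - {i}. F j x)"
  unfolding H_def by (rule prod.remove) auto

lemma H_measurable [measurable]: "H \<in> borel_measurable borel"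
  using H_mono by (intro borel_measurable_mono) (auto simp: mono_def)

text \<open>The intermediate value theorem applies because the densities make \<open>H\<close>
  continuous. The quantiles serve as the grid at which concentration is applied.\<close>

lemma H_quantile:
  assumes "0 \<le> u" "u \<le> 1"
  obtains q where "q \<in> {0..1}" "H q = u"
proof -
  have "continuous_on {0..1} H"
    unfolding H_def using F_continuous by (intro continuous_on_prod) auto
  then have "\<exists>q\<ge>0. q \<le> 1 \<and> H q = u" using H_zero H_one[of 1] assms by (intro IVT') auto
  with that show ?thesis by auto
qed

lemma F_pos: "i \<in> {1..k} \<Longrightarrow> 0 < H x \<Longrightarrow> 0 < F i x"
  using H_split[of i x] F_nonneg[of i x] by (cases "F i x = 0") auto

text \<open>The other factors of \<open>H\<close> also grow from \<open>x\<close> to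
  \<open>y\<close>, so multiplying by their ratio can only enlarge the left side. This controls the
  increments of \<open>- ln (F i)\<close> by those of \<open>H\<close>.\<close>

lemma F_ratio_le:
  assumes i: "i \<in> {1..k}" and "x \<le> y" and pos: "0 < H x"
  shows "F i y / F i x \<le> H y / H x"
proof -
  define G where "G = (\<lambda>x. \<Prod>j\<in>{1..k} - {i}. F j x)"
  have G: "G x \<le> G y" "0 \<le> G x"
    unfolding G_def using F_mono F_nonneg \<open>x \<le> y\<close> by (auto intro!: prod_mono prod_nonneg)
  have Hx: "H x = F i x * G x" "H y = F i y * G y" using H_split[OF i] by (auto simp: G_def)
  have "0 < F i x" using F_pos[OF i pos] .
  then have "0 < G x" using pos Hx(1) G(2) by (cases "G x = 0") auto
  then have "F i y / F i x * 1 \<le> F i y / F i x * (G y / G x)"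
    using G F_nonneg[OF i] by (intro mult_left_mono) auto
  then show ?thesis by (simp add: Hx)
qed

text \<open>The bids won by \<open>i\<close> have density \<open>f i\<close> times the product of
  the other \<open>F j\<close>. The weight \<open>1 / H\<close> cancels that product and leaves
  \<open>f i / F i\<close>, the derivative of \<open>ln (F i)\<close>.\<close>

lemma integral_inverse_H:
  assumes i: "i \<in> {1..k}" and x: "x \<in> {0..1}" and pos: "0 < H x"
  shows "(\<integral>w. (if snd w = i \<and> x < fst w then 1 / H (fst w) else 0) \<partial>first_price k F) = - ln (F i x)"
proof -
  have Fx: "0 < F i x" using F_pos[OF i pos] .
  define g where "g = (\<lambda>t. if x < t then 1 / H t else 0)"
  have g [measurable]: "g \<in> borel_measurable borel" unfolding g_def by measurable
  have g0: "0 \<le> g t" for t using H_nonneg by (simp add: g_def)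
  have A0: "0 \<le> - ln (F i x)" using Fx F_le_1[OF i] by simp
  have "(\<integral>\<^sup>+w. ennreal (if snd w = i \<and> x < fst w then 1 / H (fst w) else 0) \<partial>first_price k F) =
      (\<integral>\<^sup>+w. ennreal (g (fst w)) * indicator {i} (snd w) \<partial>first_price k F)"
    by (intro nn_integral_cong) (auto simp: g_def indicator_def)
  also have "\<dots> = (\<integral>\<^sup>+t. ennreal (g t) * (\<Prod>j\<in>{1..k} - {i}. ennreal (F j t)) \<partial>bid i)"
    by (rule nn_integral_won[OF i, of "\<lambda>t. ennreal (g t)"]) simp
  also have "\<dots> = (\<integral>\<^sup>+t. ennreal (if x < t then 1 / F i t else 0) \<partial>bid i)"
  proof (intro nn_integral_cong)
    fix t
    have "g t * (\<Prod>j\<in>{1..k} - {i}. F j t) = (if x < t then 1 / F i t else 0)"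
    proof (cases "x < t")
      case True
      then have Ht: "0 < H t" using H_mono[of x t] pos by simp
      define G where "G = (\<Prod>j\<in>{1..k} - {i}. F j t)"
      have HG: "H t = F i t * G" unfolding G_def by (rule H_split[OF i])
      then have "F i t \<noteq> 0" "G \<noteq> 0" using Ht by (metis mult_zero_left mult_zero_right less_irrefl)+
      with True show ?thesis unfolding G_def[symmetric] g_def HG by simp
    qed (simp add: g_def)
    moreover have "(\<Prod>j\<in>{1..k} - {i}. ennreal (F j t)) = ennreal (\<Prod>j\<in>{1..k} - {i}. F j t)"
      using F_nonneg by (intro prod_ennreal) auto
    then have "ennreal (g t) * (\<Prod>j\<in>{1..k} - {i}. ennreal (F j t)) = ennreal (g t * (\<Prod>j\<in>{1..k} - {i}. F j t))"
      by (simp only: ennreal_mult'[OF g0])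
    ultimately show "ennreal (g t) * (\<Prod>j\<in>{1..k} - {i}. ennreal (F j t)) = ennreal (if x < t then 1 / F i t else 0)"
      by simp
  qed
  also have "\<dots> = (\<integral>\<^sup>+t. ennreal ((f i t * indicator {0..1} t) * (if x < t then 1 / F i t else 0)) \<partial>lborel)"
  proof -
    have Fm [measurable]: "F i \<in> borel_measurable borel"
      using F_mono[OF i] by (intro borel_measurable_mono) (auto simp: mono_def)
    have "bid i = density lborel (\<lambda>x. ennreal (f i x * indicator {0..1} x))"
      using interval_measure_density[OF i] i by (simp add: bid_def)
    then have "(\<integral>\<^sup>+t. ennreal (if x < t then 1 / F i t else 0) \<partial>bid i) =
        (\<integral>\<^sup>+t. ennreal (f i t * indicator {0..1} t) * ennreal (if x < t then 1 / F i t else 0) \<partial>lborel)"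
    proof (simp only:, intro nn_integral_density)
      show "(\<lambda>t. ennreal (f i t * indicator {0..1} t)) \<in> borel_measurable lborel"
        using measurable_compose[OF f_measurable[OF i] measurable_ennreal] by simp
      have "(\<lambda>t. ennreal (if x < t then 1 / F i t else 0)) \<in> borel_measurable borel"
        by measurable
      then show "(\<lambda>t. ennreal (if x < t then 1 / F i t else 0)) \<in> borel_measurable lborel"
        by simp
    qed
    also have "\<dots> = (\<integral>\<^sup>+t. ennreal ((f i t * indicator {0..1} t) * (if x < t then 1 / F i t else 0)) \<partial>lborel)"
      using f_nonneg[OF i] by (intro nn_integral_cong ennreal_mult'[symmetric]) (auto simp: indicator_def)
    finally show ?thesis .
  qed
  also have "\<dots> = ennreal (- ln (F i x))"
  proof (rule nn_integral_has_integral_lborel)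
    have Fm [measurable]: "F i \<in> borel_measurable borel"
      using F_mono[OF i] by (intro borel_measurable_mono) (auto simp: mono_def)
    show "(\<lambda>t. f i t * indicator {0..1} t * (if x < t then 1 / F i t else 0)) \<in> borel_measurable borel"
      using f_measurable[OF i] by measurable
    have "((\<lambda>t. if t \<in> {x..1} then f i t / F i t else 0) has_integral - ln (F i x)) UNIV"
      using F_log_integral[OF i x Fx] by (subst has_integral_restrict_UNIV)
    then show "((\<lambda>t. f i t * indicator {0..1} t * (if x < t then 1 / F i t else 0)) has_integral - ln (F i x)) UNIV"
      \<comment> \<open>The strict condition \<open>x < t\<close> and the closed interval
        \<open>{x..1}\<close> differ only at the null point \<open>x\<close>.\<close>
      by (rule has_integral_spike[of "{x}", rotated 2]) (use x in \<open>auto simp: indicator_def\<close>)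
    show "0 \<le> f i t * indicator {0..1} t * (if x < t then 1 / F i t else 0)" for t
      using f_nonneg[OF i] F_nonneg[OF i] by (auto simp: indicator_def)
  qed
  finally show ?thesis using A0 H_nonneg
    by (subst integral_eq_nn_integral) (auto simp: enn2real_ennreal)
qed

end


section \<open>Concentration\<close>

text \<open>Two-sided Hoeffding for the sample mean of a function with values in the unit interval.
  The work lies in showing that the coordinates of a product space are independent and identically
  distributed.\<close>

lemma (in prob_space) iid_mean_deviation:
  fixes g :: "'a \<Rightarrow> real"
  assumes g [measurable]: "g \<in> borel_measurable M"
    and bounds: "\<And>x. 0 \<le> g x" "\<And>x. g x \<le> 1"
    and "0 < n" "0 \<le> \<alpha>"
  shows "measure (PiM {..<n} (\<lambda>_. M))
      {S \<in> space (PiM {..<n} (\<lambda>_. M)). \<alpha> \<le> \<bar>(\<Sum>j<n. g (S j)) / real n - expectation g\<bar>}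
    \<le> 2 * exp (- 2 * real n * \<alpha>\<^sup>2)"
proof -
  let ?P = "PiM {..<n} (\<lambda>_. M)"
  interpret P: prob_space ?P by (intro prob_space_PiM prob_space_axioms)
  have comp [measurable]: "(\<lambda>S. S j) \<in> measurable ?P M" if "j < n" for j
    using that by (intro measurable_component_singleton) auto
  have distr_comp: "distr ?P M (\<lambda>S. S j) = M" if "j < n" for j
    using that by (intro distr_PiM_component prob_space_axioms) auto
  have distr_g: "distr ?P borel (\<lambda>S. g (S j)) = distr M borel g" if "j < n" for j
    using that distr_distr[OF g comp, of j] by (simp add: distr_comp comp_def)
  have ne: "{..<n} \<noteq> {}" using \<open>0 < n\<close> by auto
  have "P.indep_vars (\<lambda>_. M) (\<lambda>j S. S j) {..<n}"
  proof (subst P.indep_vars_iff_distr_eq_PiM'[OF ne])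
    \<comment> \<open>Independence is equality of the joint law with the product of the marginals;
      on the space of the product measure the restriction to \<open>{..<n}\<close> is the
      identity.\<close>
    have "distr ?P ?P (\<lambda>S. \<lambda>j\<in>{..<n}. S j) = distr ?P ?P (\<lambda>S. S)"
      by (intro distr_cong) (auto simp: space_PiM)
    also have "\<dots> = PiM {..<n} (\<lambda>j. distr ?P M (\<lambda>S. S j))"
      using distr_comp by (auto simp: distr_id intro!: PiM_cong)
    finally show "distr ?P ?P (\<lambda>S. \<lambda>j\<in>{..<n}. S j) = PiM {..<n} (\<lambda>j. distr ?P M (\<lambda>S. S j))" .
  qed (use comp in auto)
  then have indep: "P.indep_vars (\<lambda>_. borel) (\<lambda>j S. g (S j)) {..<n}"
    by (rule P.indep_vars_compose2) measurable
  have "iid_interval_bounded_random_variables ?P {..<n} (\<lambda>j S. g (S j)) (\<lambda>S. g (S 0)) 0 1"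
  proof unfold_locales
    show "P.indep_vars (\<lambda>_. borel) (\<lambda>j S. g (S j)) {..<n}" by (rule indep)
    show "distr ?P borel (\<lambda>S. g (S j)) = distr ?P borel (\<lambda>S. g (S 0))" if "j \<in> {..<n}" for j
      using that distr_g[of j] distr_g[of 0] \<open>0 < n\<close> by simp
    show "(\<lambda>S. g (S 0)) \<in> borel_measurable ?P"
      using \<open>0 < n\<close> by (intro measurable_compose[OF comp g])
    show "AE S in ?P. g (S 0) \<in> {0..1}" using bounds by simp
    show "finite {..<n}" by simp
  qed
  then have iid: "Hoeffding_ineq_iid ?P {..<n} (\<lambda>j S. g (S j)) (\<lambda>S. g (S 0)) 0 1"
    by (simp add: Hoeffding_ineq_iid_def)
  have "P.expectation (\<lambda>S. g (S 0)) = expectation g"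
    using integral_distr[OF comp g, of 0] distr_comp[of 0] \<open>0 < n\<close> by simp
  then show ?thesis
    using Hoeffding_ineq_iid.Hoeffding_ineq_abs_ge'[OF iid \<open>0 \<le> \<alpha>\<close>] ne by simp
qed


section \<open>The product-limit estimator\<close>

definition rank :: "nat \<Rightarrow> (nat \<Rightarrow> real \<times> nat) \<Rightarrow> real \<Rightarrow> nat" where
  "rank n S y = (\<Sum>j<n. of_bool (fst (S j) \<le> y))"

text \<open>In terms of survival analysis, time runs from 1 down to 0, the rank is the number still
  at risk, and a bid won by somebody else censors the bid of \<open>i\<close>.\<close>

definition product_limit :: "nat \<Rightarrow> (nat \<Rightarrow> real \<times> nat) \<Rightarrow> nat \<Rightarrow> real \<Rightarrow> real" where
  "product_limit n S i y =
     (\<Prod>j<n. if snd (S j) = i \<and> y < fst (S j) then 1 - 1 / real (rank n S (fst (S j))) else 1)"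

lemma rank_mono: "y \<le> z \<Longrightarrow> rank n S y \<le> rank n S z"
  unfolding rank_def by (intro sum_mono) auto

lemma rank_le: "rank n S y \<le> n"
proof -
  have "rank n S y \<le> (\<Sum>j<n. 1)" unfolding rank_def by (intro sum_mono) auto
  then show ?thesis by simp
qed

lemma rank_pos: "j < n \<Longrightarrow> 0 < rank n S (fst (S j))"
  unfolding rank_def by (intro sum_pos2[of _ j]) auto

lemma product_limit_factor:
  assumes "j < n"
  shows "0 \<le> 1 - 1 / real (rank n S (fst (S j)))" and "1 - 1 / real (rank n S (fst (S j))) \<le> 1"
  using rank_pos[OF assms, of S] by auto

lemma product_limit_bounds: "product_limit n S i y \<in> {0..1}"
  unfolding product_limit_def using product_limit_factor by (auto intro!: prod_nonneg prod_le_1)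

text \<open>One side is \<open>1 - t \<le> exp (- t)\<close>. For the other,
  \<open>exp (- t) \<le> 1 / (1 + t)\<close>, and \<open>(1 + t) * (1 - t + t^2) = 1 + t^3\<close>
  is at least 1.\<close>

lemma exp_minus_quadratic:
  fixes t :: real assumes "0 \<le> t" shows "\<bar>1 - t - exp (- t)\<bar> \<le> t\<^sup>2"
proof -
  have "exp (- t) * (1 + t) \<le> exp (- t) * exp t" using exp_ge_add_one_self[of t] by (intro mult_left_mono) auto
  then have "exp (- t) * (1 + t) \<le> 1" by (simp add: exp_minus)
  then have "exp (- t) \<le> 1 / (1 + t)" using assms by (simp add: field_simps)
  also have "\<dots> \<le> 1 - t + t\<^sup>2" using assms by (simp add: field_simps power2_eq_square)
  finally show ?thesis using exp_ge_add_one_self[of "- t"] by simp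
qed

lemma abs_exp_minus_diff_le:
  fixes a b :: real assumes "0 \<le> a" "0 \<le> b" shows "\<bar>exp (- a) - exp (- b)\<bar> \<le> \<bar>a - b\<bar>"
proof -
  have *: "\<bar>exp (- a) - exp (- b)\<bar> \<le> \<bar>a - b\<bar>" if "0 \<le> a" "a \<le> b" for a b :: real
  proof -
    have "exp (- a) - exp (- b) = exp (- a) * (1 - exp (- (b - a)))" by (simp add: algebra_simps flip: exp_add)
    also have "\<dots> \<le> 1 * (1 - exp (- (b - a)))" using that by (intro mult_right_mono) auto
    also have "\<dots> \<le> b - a" using exp_ge_add_one_self[of "- (b - a)"] unfolding mult_1_left by linarith
    finally show ?thesis using that by simp
  qed
  show ?thesis using *[of a b] *[of b a] assms by (cases "a \<le> b") auto
qed

text \<open>Here \<open>A\<close> plays the role of \<open>- ln F\<^sub>i\<close> and \<open>q m\<close> is an \<open>m/n\<close>-quantile of \<open>H\<close>. The factor \<open>m/n\<close> in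
  the last assumption makes the summands lie in the unit interval, as Hoeffding's inequality wants.\<close>

locale deviation_bounds =
  fixes n i :: nat and S :: "nat \<Rightarrow> real \<times> nat" and H A :: "real \<Rightarrow> real"
    and q :: "nat \<Rightarrow> real" and \<alpha> :: real
  assumes n_pos: "0 < n" and inverse_n: "1 / real n \<le> \<alpha>"
    and H_mono: "x \<le> y \<Longrightarrow> H x \<le> H y" and H_nonneg: "0 \<le> H x" and H_le_1: "H x \<le> 1"
    and A_diff: "x \<le> y \<Longrightarrow> 0 < H x \<Longrightarrow> A y \<le> A x \<and> A x - A y \<le> H y / H x - 1"
    and A_bounds: "0 < H x \<Longrightarrow> 0 \<le> A x \<and> A x \<le> 1 / H x - 1"
    and H_q: "m \<in> {1..n} \<Longrightarrow> H (q m) = real m / real n"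
    and rank_q: "m \<in> {1..n} \<Longrightarrow> \<bar>real (rank n S (q m)) / real n - real m / real n\<bar> \<le> \<alpha>"
    and mean_q: "m \<in> {1..n} \<Longrightarrow>
      \<bar>(\<Sum>j<n. real m / real n * (if snd (S j) = i \<and> q m < fst (S j) then 1 / H (fst (S j)) else 0)) / real n
        - real m / real n * A (q m)\<bar> \<le> \<alpha>"
begin

text \<open>Strictness matters: as \<open>H\<close> is only weakly monotone, the order of a point
  and a quantile can be read off only from a strict inequality between their values under
  \<open>H\<close>.\<close>

lemma grid_above:
  assumes "0 \<le> u" "u < 1"
  obtains m where "m \<in> {1..n}" "u < real m / real n" "real m / real n \<le> u + 1 / real n"
proof (rule that[of "nat \<lfloor>u * real n\<rfloor> + 1"])
  have "u * real n < 1 * real n" using assms n_pos by (intro mult_strict_right_mono) auto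
  then have "nat \<lfloor>u * real n\<rfloor> < n" using assms by (simp add: nat_less_iff floor_less_iff)
  then show "nat \<lfloor>u * real n\<rfloor> + 1 \<in> {1..n}" by simp
  have e: "real (nat \<lfloor>u * real n\<rfloor> + 1) = of_int \<lfloor>u * real n\<rfloor> + 1" using assms by simp
  have "u * real n < of_int \<lfloor>u * real n\<rfloor> + 1" "of_int \<lfloor>u * real n\<rfloor> \<le> u * real n" by linarith+
  then show "u < real (nat \<lfloor>u * real n\<rfloor> + 1) / real n" "real (nat \<lfloor>u * real n\<rfloor> + 1) / real n \<le> u + 1 / real n"
    unfolding e using n_pos by (auto simp: field_simps)
qed

text \<open>The bound \<open>1 / n < u\<close> guarantees a grid index of at least 1, since the grid
  has no quantile at level 0.\<close>

lemma grid_below: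
  assumes "1 / real n < u" "u \<le> 1"
  obtains m where "m \<in> {1..n}" "real m / real n < u" "u \<le> real m / real n + 1 / real n"
proof (rule that[of "nat (\<lceil>u * real n\<rceil> - 1)"])
  have u1: "1 < u * real n" using assms n_pos by (simp add: field_simps)
  have "u * real n \<le> 1 * real n" using assms n_pos by (intro mult_right_mono) auto
  then have "\<lceil>u * real n\<rceil> \<le> int n" by (simp add: ceiling_le_iff)
  moreover have "2 \<le> \<lceil>u * real n\<rceil>" using u1 by (simp add: le_ceiling_iff)
  ultimately show "nat (\<lceil>u * real n\<rceil> - 1) \<in> {1..n}" by (simp add: le_nat_iff)
  have e: "real (nat (\<lceil>u * real n\<rceil> - 1)) = of_int \<lceil>u * real n\<rceil> - 1"
    using \<open>2 \<le> \<lceil>u * real n\<rceil>\<close> by simp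
  have "of_int \<lceil>u * real n\<rceil> - 1 < u * real n" "u * real n \<le> of_int \<lceil>u * real n\<rceil>" by linarith+
  then show "real (nat (\<lceil>u * real n\<rceil> - 1)) / real n < u"
    "u \<le> real (nat (\<lceil>u * real n\<rceil> - 1)) / real n + 1 / real n"
    unfolding e using n_pos by (auto simp: field_simps)
qed

lemma alpha_pos: "0 < \<alpha>"
  using inverse_n n_pos by (meson less_le_trans zero_less_divide_1_iff of_nat_0_less_iff)

text \<open>Rank and \<open>H\<close> are both monotone, so the error at \<open>y\<close> is at most
  the error \<alpha> at a neighbouring grid point plus the mesh \<open>1 / n\<close>, which is again
  at most \<alpha>. Where the grid has no neighbour, the trivial bounds 0 and 1 on the empirical
  distribution function suffice.\<close>

lemma rank_deviation: "\<bar>real (rank n S y) / real n - H y\<bar> \<le> 2 * \<alpha>"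
proof -
  have "real (rank n S y) / real n \<le> H y + 2 * \<alpha>"
  proof (cases "H y < 1")
    case True
    obtain m where m: "m \<in> {1..n}" "H y < real m / real n" "real m / real n \<le> H y + 1 / real n"
      using grid_above[OF H_nonneg True] .
    have "y \<le> q m" using H_mono[of "q m" y] H_q[OF m(1)] m(2) by linarith
    then have "real (rank n S y) / real n \<le> real (rank n S (q m)) / real n"
      using rank_mono by (intro divide_right_mono) auto
    also have "\<dots> \<le> real m / real n + \<alpha>" using rank_q[OF m(1)] by linarith
    finally show ?thesis using m(3) inverse_n by linarith
  next
    case False
    have "real (rank n S y) / real n \<le> 1" using rank_le[of n S y] n_pos by simp
    then show ?thesis using False alpha_pos by linarith
  qed
  moreover have "H y - 2 * \<alpha> \<le> real (rank n S y) / real n"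
  proof (cases "1 / real n < H y")
    case True
    obtain m where m: "m \<in> {1..n}" "real m / real n < H y" "H y \<le> real m / real n + 1 / real n"
      using grid_below[OF True H_le_1] .
    have "q m \<le> y" using H_mono[of y "q m"] H_q[OF m(1)] m(2) by linarith
    then have "real (rank n S (q m)) / real n \<le> real (rank n S y) / real n"
      using rank_mono by (intro divide_right_mono) auto
    moreover have "real m / real n - \<alpha> \<le> real (rank n S (q m)) / real n" using rank_q[OF m(1)] by linarith
    ultimately show ?thesis using m(3) inverse_n by linarith
  next
    case False
    have "0 \<le> real (rank n S y) / real n" by simp
    then show ?thesis using False inverse_n alpha_pos by linarith
  qed
  ultimately show ?thesis by linarith
qed

text \<open>An average of independent terms, which Hoeffding's inequality can handle, but not
  computable from the samples because it contains the true \<open>H\<close>.\<close>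

definition mean_hazard :: "real \<Rightarrow> real" where
  "mean_hazard x = (\<Sum>j<n. if snd (S j) = i \<and> x < fst (S j) then 1 / H (fst (S j)) else 0) / real n"

text \<open>The Nelson-Aalen estimator, the computable counterpart of
  \<open>mean_hazard\<close>.\<close>

definition rank_hazard :: "real \<Rightarrow> real" where
  "rank_hazard x =
     (\<Sum>j<n. if snd (S j) = i \<and> x < fst (S j) then 1 / real (rank n S (fst (S j))) else 0)"

lemma mean_hazard_antimono: "x \<le> y \<Longrightarrow> mean_hazard y \<le> mean_hazard x"
  unfolding mean_hazard_def using H_nonneg
  by (intro divide_right_mono sum_mono) auto

lemma mean_hazard_q:
  assumes "m \<in> {1..n}"
  shows "\<bar>mean_hazard (q m) - A (q m)\<bar> \<le> \<alpha> / (real m / real n)"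
proof -
  define c where "c = real m / real n"
  have c: "0 < c" using assms n_pos by (simp add: c_def)
  have "(\<Sum>j<n. c * (if snd (S j) = i \<and> q m < fst (S j) then 1 / H (fst (S j)) else 0)) / real n
      = c * mean_hazard (q m)"
    unfolding mean_hazard_def by (simp only: sum_distrib_left[symmetric] times_divide_eq_right)
  then have "\<bar>c * mean_hazard (q m) - c * A (q m)\<bar> \<le> \<alpha>" using mean_q[OF assms] unfolding c_def by metis
  then have "c * \<bar>mean_hazard (q m) - A (q m)\<bar> \<le> \<alpha>" using c by (simp add: abs_mult flip: right_diff_distrib)
  then show ?thesis using c by (simp add: field_simps flip: c_def)
qed

context
  fixes x :: real
  assumes large: "4 * \<alpha> \<le> H x"
begin

lemma Hx_pos: "0 < H x"
  using large alpha_pos by linarith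

text \<open>Squeeze \<open>x\<close> against an adjacent quantile: \<open>mean_hazard\<close> is
  monotone, its error at a quantile is known, and \<open>A\<close> moves between the two points by
  at most the relative change of \<open>H\<close>.\<close>

lemma mean_hazard_deviation: "\<bar>mean_hazard x - A x\<bar> \<le> 4 * \<alpha> / H x"
proof -
  define u where "u = H x"
  have u: "0 < u" "4 * \<alpha> \<le> u" "u \<le> 1" using Hx_pos large H_le_1 by (auto simp: u_def)
  have "mean_hazard x \<le> A x + 4 * \<alpha> / u"
  proof -
    have u_gt: "1 / real n < u" using inverse_n u alpha_pos by linarith
    obtain m where m: "m \<in> {1..n}" "real m / real n < u" "u \<le> real m / real n + 1 / real n"
      using grid_below[OF u_gt u(3)] .
    define c where "c = real m / real n"
    \<comment> \<open>Because \<open>4 * \<alpha> \<le> u\<close>, moving down by one mesh width at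
      most halves the level. Both error terms are then at most \<open>\<alpha> / (u / 2)\<close>,
      which explains the constant 4.\<close>
    have c: "u / 2 \<le> c" "c < u" "u - c \<le> \<alpha>" using m inverse_n u alpha_pos by (auto simp: c_def)
    have c0: "0 < c" using c u by linarith
    have qx: "q m \<le> x" using H_mono[of x "q m"] H_q[OF m(1)] m(2) by (fastforce simp: u_def)
    have "mean_hazard x \<le> mean_hazard (q m)" by (rule mean_hazard_antimono[OF qx])
    also have "\<dots> \<le> A (q m) + \<alpha> / c" using mean_hazard_q[OF m(1)] by (simp add: c_def abs_le_iff)
    also have "A (q m) \<le> A x + (u / c - 1)"
      using A_diff[OF qx] H_q[OF m(1)] c0 by (auto simp: c_def u_def)
    also have "u / c - 1 = (u - c) / c" using c0 by (simp add: field_simps)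
    also have "\<dots> \<le> \<alpha> / c" using c c0 by (intro divide_right_mono) auto
    also have "\<alpha> / c \<le> \<alpha> / (u / 2)" using c u alpha_pos by (intro divide_left_mono) auto
    finally show ?thesis by (simp add: add.commute)
  qed
  moreover have "A x - 4 * \<alpha> / u \<le> mean_hazard x"
  proof (cases "u < 1")
    case True
    obtain m where m: "m \<in> {1..n}" "u < real m / real n" "real m / real n \<le> u + 1 / real n"
      using grid_above[OF less_imp_le[OF u(1)] True] .
    define c where "c = real m / real n"
    have c: "u < c" "c - u \<le> \<alpha>" using m inverse_n by (auto simp: c_def)
    have xq: "x \<le> q m" using H_mono[of "q m" x] H_q[OF m(1)] m(2) by (fastforce simp: u_def)
    have "A x \<le> A (q m) + (c / u - 1)" using A_diff[OF xq Hx_pos] H_q[OF m(1)] by (auto simp: c_def u_def)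
    also have "A (q m) \<le> mean_hazard (q m) + \<alpha> / c" using mean_hazard_q[OF m(1)] by (simp add: c_def abs_le_iff)
    also have "mean_hazard (q m) \<le> mean_hazard x" by (rule mean_hazard_antimono[OF xq])
    also have "\<alpha> / c \<le> \<alpha> / u" using c u alpha_pos by (intro divide_left_mono) auto
    also have "c / u - 1 = (c - u) / u" using u by (simp add: field_simps)
    also have "\<dots> \<le> \<alpha> / u" using c u by (intro divide_right_mono) auto
    finally have "A x \<le> mean_hazard x + 2 * (\<alpha> / u)" by simp
    moreover have "0 \<le> \<alpha> / u" using u alpha_pos by simp
    ultimately show ?thesis by simp
  next
    case False
    \<comment> \<open>At level 1 there is no quantile above, but
      \<open>A x \<le> 1 / H x - 1\<close> already vanishes.\<close>
    have "A x \<le> 0" using A_bounds[OF Hx_pos] False u by (auto simp: u_def)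
    moreover have "0 \<le> mean_hazard x"
      unfolding mean_hazard_def using H_nonneg by (intro divide_nonneg_nonneg sum_nonneg) auto
    moreover have "0 \<le> 4 * \<alpha> / u" using u alpha_pos by simp
    ultimately show ?thesis by linarith
  qed
  ultimately show ?thesis unfolding u_def by linarith
qed

text \<open>The rank deviation \<open>2 * \<alpha>\<close> uses up at most half of
  \<open>H x\<close>. This is the purpose of the standing assumption
  \<open>4 * \<alpha> \<le> H x\<close>: denominators to the right of \<open>x\<close> stay under
  control.\<close>

lemma rank_ge: "x \<le> y \<Longrightarrow> real n * H x / 2 \<le> real (rank n S y)"
proof -
  assume "x \<le> y"
  then have "H x / 2 \<le> real (rank n S y) / real n"
    using H_mono[of x y] rank_deviation[of y] large by linarith
  then show ?thesis using n_pos by (simp add: field_simps)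
qed

text \<open>Compare term by term: reciprocals of \<open>r\<close> and \<open>H y\<close> differ by
  \<open>\<bar>r - H y\<bar> / (r * H y)\<close>, with numerator at most \<open>2 * \<alpha>\<close>
  and denominator at least half the square of \<open>H x\<close>. There are \<open>n\<close> terms,
  each weighted by \<open>1 / n\<close>.\<close>

lemma rank_hazard_deviation: "\<bar>rank_hazard x - mean_hazard x\<bar> \<le> 4 * \<alpha> / (H x)\<^sup>2"
proof -
  have u: "0 < H x" by (rule Hx_pos)
  have "\<bar>1 / real (rank n S y) - 1 / H y / real n\<bar> \<le> 4 * \<alpha> / (H x)\<^sup>2 / real n" if "x < y" for y
  proof -
    define r where "r = real (rank n S y) / real n"
    have Hy: "H x \<le> H y" using that H_mono by simp
    have r: "H x / 2 \<le> r" using rank_ge[of y] that n_pos by (simp add: r_def field_simps)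
    have "\<bar>1 / r - 1 / H y\<bar> = \<bar>r - H y\<bar> / (r * H y)"
    proof -
      have "1 / r - 1 / H y = - ((r - H y) / (r * H y))" using r u Hy by (simp add: field_simps)
      then show ?thesis using r u Hy by (simp add: abs_mult)
    qed
    also have "\<dots> \<le> 2 * \<alpha> / (H x / 2 * H x)"
      using r u Hy rank_deviation[of y] alpha_pos
      by (intro frac_le mult_mono) (auto simp: r_def)
    also have "\<dots> = 4 * \<alpha> / (H x)\<^sup>2" using u by (simp add: field_simps power2_eq_square)
    finally have "\<bar>1 / r - 1 / H y\<bar> / real n \<le> 4 * \<alpha> / (H x)\<^sup>2 / real n"
      using n_pos by (intro divide_right_mono) auto
    moreover have "1 / real (rank n S y) = 1 / r / real n" using n_pos by (simp add: r_def)
    moreover have "\<bar>1 / r / real n - 1 / H y / real n\<bar> = \<bar>1 / r - 1 / H y\<bar> / real n"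
      by (simp only: diff_divide_distrib[symmetric] abs_divide abs_of_nat)
    ultimately show ?thesis by simp
  qed
  moreover have "0 \<le> 4 * \<alpha> / (H x)\<^sup>2 / real n" using alpha_pos by simp
  ultimately have "(\<Sum>j<n. \<bar>(if snd (S j) = i \<and> x < fst (S j) then 1 / real (rank n S (fst (S j))) else 0)
      - (if snd (S j) = i \<and> x < fst (S j) then 1 / H (fst (S j)) else 0) / real n\<bar>)
    \<le> (\<Sum>j<n. 4 * \<alpha> / (H x)\<^sup>2 / real n)"
    by (intro sum_mono) auto
  also have "\<dots> = 4 * \<alpha> / (H x)\<^sup>2" using n_pos by simp
  finally show ?thesis
    unfolding rank_hazard_def mean_hazard_def sum_divide_distrib sum_subtractf[symmetric]
    by (rule order_trans[OF sum_abs])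
qed

text \<open>Products of numbers in the unit interval differ by at most the sum of the differences of
  their factors. Each factor is off by at most the square of \<open>t j\<close>, which is of order
  \<open>1 / n^2\<close>, so \<open>n\<close> of them cost only order \<open>1 / n\<close>.\<close>

lemma product_limit_exp: "\<bar>product_limit n S i x - exp (- rank_hazard x)\<bar> \<le> 4 * \<alpha> / (H x)\<^sup>2"
proof -
  have u: "0 < H x" by (rule Hx_pos)
  define t where "t = (\<lambda>j. if snd (S j) = i \<and> x < fst (S j) then 1 / real (rank n S (fst (S j))) else 0)"
  have t: "0 \<le> t j" "t j \<le> 1" "t j \<le> 2 / (real n * H x)" if "j < n" for j
  proof -
    show "0 \<le> t j" by (simp add: t_def)
    show "t j \<le> 1" using rank_pos[OF that, of S] by (simp add: t_def)
    have "1 / real (rank n S (fst (S j))) \<le> 1 / (real n * H x / 2)" if "x < fst (S j)"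
      using rank_ge[of "fst (S j)"] that u n_pos
      by (intro divide_left_mono) (auto intro!: mult_pos_pos simp: rank_pos[OF \<open>j < n\<close>])
    then show "t j \<le> 2 / (real n * H x)" using u by (simp add: t_def)
  qed
  have "product_limit n S i x = (\<Prod>j<n. 1 - t j)"
    unfolding product_limit_def t_def by (intro prod.cong) auto
  moreover have "exp (- rank_hazard x) = (\<Prod>j<n. exp (- t j))"
    unfolding rank_hazard_def t_def[symmetric] by (simp add: exp_sum flip: sum_negf)
  ultimately have "\<bar>product_limit n S i x - exp (- rank_hazard x)\<bar> \<le> (\<Sum>j<n. \<bar>1 - t j - exp (- t j)\<bar>)"
    using norm_prod_diff[of "{..<n}" "\<lambda>j. 1 - t j" "\<lambda>j. exp (- t j)"] t by auto
  also have "\<dots> \<le> (\<Sum>j<n. (2 / (real n * H x))\<^sup>2)"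
    using t by (intro sum_mono order_trans[OF exp_minus_quadratic] power_mono) auto
  also have "\<dots> = 4 * (1 / real n) / (H x)\<^sup>2" using n_pos u by (simp add: power2_eq_square)
  also have "\<dots> \<le> 4 * \<alpha> / (H x)\<^sup>2" using inverse_n by (intro divide_right_mono mult_left_mono) auto
  finally show ?thesis .
qed

text \<open>Three errors of \<open>4 * \<alpha> / (H x)^2\<close> add up: product against
  exponential, ranks against \<open>H\<close>, and sample mean against expectation.\<close>

lemma product_limit_deviation: "\<bar>product_limit n S i x - exp (- A x)\<bar> \<le> 12 * \<alpha> / (H x)\<^sup>2"
proof -
  have "0 \<le> rank_hazard x" unfolding rank_hazard_def by (intro sum_nonneg) auto
  then have "\<bar>exp (- rank_hazard x) - exp (- A x)\<bar> \<le> \<bar>rank_hazard x - A x\<bar>"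
    using A_bounds[OF Hx_pos] by (intro abs_exp_minus_diff_le) auto
  moreover have "4 * \<alpha> / H x \<le> 4 * \<alpha> / (H x)\<^sup>2"
    using Hx_pos H_le_1[of x] alpha_pos by (intro divide_left_mono) (auto simp: power2_eq_square mult_le_cancel_right1)
  ultimately show ?thesis
    using product_limit_exp rank_hazard_deviation mean_hazard_deviation by linarith
qed

end
end


section \<open>The estimator and its program\<close>

text \<open>A generous absolute size above which the logarithmic estimates hold with room to spare.
  Below it the estimate is constant, which is accurate enough because the sample bound then forces
  \<open>L\<close> to be small (\<open>small_sample\<close>).\<close>

definition threshold :: nat where "threshold = 10 ^ 20"

text \<open>An upper approximation of the binary logarithm of \<open>4 n / \<delta>\<close>. Its computation takes one step per
  unit, so it has to be cut off at \<open>n\<close> to stay polynomial in \<open>n\<close> when \<open>\<delta>\<close> is tiny.\<close>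

definition log_bound :: "real \<Rightarrow> nat \<Rightarrow> nat" where
  "log_bound \<delta> n = (LEAST m. m = n \<or> 4 * real n \<le> 2 ^ m * \<delta>)"

text \<open>With \<open>l = window L \<delta> n\<close> and \<open>b = l/n\<close>, the defining inequality reads \<open>log_bound \<delta> n \<le> 2 n \<alpha>\<^sup>2\<close>
  for \<open>\<alpha> = L b\<^sup>2\<close>; the step \<open>b / H(x)\<close> then becomes \<open>l\<close> divided by the rank of \<open>x\<close>.\<close>

definition window :: "real \<Rightarrow> real \<Rightarrow> nat \<Rightarrow> nat" where
  "window L \<delta> n = (LEAST l. l = n \<or> real (log_bound \<delta> n) * real n ^ 3 \<le> 2 * L\<^sup>2 * real l ^ 4)"

text \<open>The test \<open>x r + l < r\<close> says that \<open>x + l/r < 1\<close>, and it fails when \<open>r = 0\<close>.\<close>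

definition density_estimate :: estimator where
  "density_estimate k L \<delta> n S i x =
     (let l = real (window L \<delta> n); r = real (rank n S x) in
      if threshold \<le> n \<and> x * r + l < r
      then (product_limit n S i (x + l / r) - product_limit n S i x) / (l / r)
      else 1)"

lemma rank_0: "rank 0 S y = 0"
  by (simp add: rank_def)

lemma rank_Suc: "rank (Suc j) S y = rank j S y + of_bool (fst (S j) \<le> y)"
  unfolding rank_def by (rule sum.lessThan_Suc)

section \<open>Time-bounded total correctness of programs\<close>

definition runs :: "com \<Rightarrow> memory \<Rightarrow> nat \<Rightarrow> (memory \<Rightarrow> bool) \<Rightarrow> bool" where
  "runs c s T Q \<longleftrightarrow> (\<exists>t s'. exec c s t s' \<and> t \<le> T \<and> Q s')"

lemma runs_mono: "runs c s T Q \<Longrightarrow> T \<le> T' \<Longrightarrow> (\<And>s'. Q s' \<Longrightarrow> Q' s') \<Longrightarrow> runs c s T' Q'"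
  unfolding runs_def by (meson order_trans)

lemma runs_Skip: "Q s \<Longrightarrow> 0 < T \<Longrightarrow> runs Skip s T Q"
  unfolding runs_def using exec.Skip[of s] by (metis One_nat_def Suc_leI)

lemma runs_NAssign: "Q (nstore a (nval e s) (nval e' s) s) \<Longrightarrow> 0 < T \<Longrightarrow> runs (NAssign a e e') s T Q"
  unfolding runs_def using exec.NAssign[of a e e' s] by (metis One_nat_def Suc_leI)

lemma runs_RAssign: "Q (rstore a (nval e s) (rval e' s) s) \<Longrightarrow> 0 < T \<Longrightarrow> runs (RAssign a e e') s T Q"
  unfolding runs_def using exec.RAssign[of a e e' s] by (metis One_nat_def Suc_leI)

text \<open>The run of the second command is itself the postcondition of the first, so that no
  intermediate assertion has to be invented.\<close>

lemma runs_Seq: "runs c1 s T1 (\<lambda>s'. runs c2 s' T2 Q) \<Longrightarrow> runs (Seq c1 c2) s (T1 + T2) Q"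
  unfolding runs_def by (meson add_mono exec.Seq)

lemma runs_Cond:
  assumes "bval b s \<Longrightarrow> runs c1 s T Q" and "\<not> bval b s \<Longrightarrow> runs c2 s T Q"
  shows "runs (Cond b c1 c2) s (Suc T) Q"
proof (cases "bval b s")
  case True
  with assms(1) show ?thesis unfolding runs_def by (meson Suc_le_mono exec.CondTrue)
next
  case False
  with assms(2) show ?thesis unfolding runs_def by (meson Suc_le_mono exec.CondFalse)
qed

text \<open>For loops whose number \<open>N\<close> of rounds is known beforehand. The invariant is
  indexed by the round; each round pays one extra unit for its guard, and the failing guard at the
  end pays the final unit.\<close>

lemma runs_While:
  assumes "I 0 s"
    and step: "\<And>j s. j < N \<Longrightarrow> I j s \<Longrightarrow> bval b s \<and> runs c s T (I (Suc j))"
    and final: "\<And>s. I N s \<Longrightarrow> \<not> bval b s"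
  shows "runs (While b c) s (N * Suc T + 1) (I N)"
proof -
  \<comment> \<open>Generalised to a start in round \<open>j\<close>, so that induction on the
    remaining rounds goes through.\<close>
  have "runs (While b c) s ((N - j) * Suc T + 1) (I N)" if "j \<le> N" "I j s" for j s
    using that
  proof (induction "N - j" arbitrary: j s)
    case 0
    then have "j = N" by simp
    with 0 final have "exec (While b c) s 1 s" by (blast intro: exec.WhileFalse)
    moreover have "I N s" using 0 \<open>j = N\<close> by simp
    ultimately show ?case unfolding runs_def by (intro exI[of _ 1] exI[of _ s]) simp
  next
    case (Suc d)
    then have "j < N" by simp
    from step[OF this Suc.prems(2)] obtain t s' where
      b: "bval b s" and body: "exec c s t s'" "t \<le> T" "I (Suc j) s'"
      unfolding runs_def by blast
    have "d = N - Suc j" "Suc j \<le> N" using Suc.hyps(2) \<open>j < N\<close> by auto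
    from Suc.hyps(1)[OF this body(3)] obtain t' s'' where
      rest: "exec (While b c) s' t' s''" "t' \<le> (N - Suc j) * Suc T + 1" "I N s''"
      unfolding runs_def by blast
    have "N - j = Suc (N - Suc j)" using \<open>j < N\<close> by simp
    then have "Suc (t + t') \<le> (N - j) * Suc T + 1" using body(2) rest(2) by simp
    with exec.WhileTrue[OF b body(1) rest(1)] rest(3) show ?case unfolding runs_def by blast
  qed
  from this[of 0 s] assms(1) show ?thesis by simp
qed

text \<open>Both arrays with number 2 hold the scalar variables. The natural numbers in it are 0: \<open>log_bound\<close>,
  1: \<open>window\<close>, 2 and 3: the loop counters over the samples, 4: the rank of \<open>x\<close>, 5: the rank of the
  current sample. The reals are 0: the result, 1: the powers of two, 2: the point \<open>x + l/r\<close>, 3 and 4: the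
  two product-limit estimates.\<close>

abbreviation "nvar v \<equiv> NGet 2 (NConst v)"
abbreviation "rvar v \<equiv> RGet 2 (NConst v)"
abbreviation "nset v e \<equiv> NAssign 2 (NConst v) e"
abbreviation "rset v e \<equiv> RAssign 2 (NConst v) e"
abbreviation "n_samples \<equiv> NGet 0 (NConst 0)"

section \<open>The subroutines and the complete program\<close>

definition rank_prog :: "nat \<Rightarrow> rexp \<Rightarrow> com" where
  "rank_prog v e =
    Seq (nset v (NConst 0)) (Seq (nset 3 (NConst 0))
     (While (NLess (nvar 3) n_samples)
       (Seq (Cond (RLess e (RGet 1 (nvar 3))) Skip (nset v (NPlus (nvar v) (NConst 1))))
         (nset 3 (NPlus (nvar 3) (NConst 1))))))"

definition log_bound_prog :: com where
  "log_bound_prog =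
    Seq (rset 1 (ROfNat (NConst 1)))
     (While (BAnd (NLess (nvar 0) n_samples)
         (RLess (RTimes (rvar 1) (RGet 0 (NConst 1))) (RTimes (ROfNat (NConst 4)) (ROfNat n_samples))))
       (Seq (nset 0 (NPlus (nvar 0) (NConst 1))) (rset 1 (RPlus (rvar 1) (rvar 1)))))"

text \<open>Powers are formed by multiplying reals, since the machine only adds and subtracts
  natural numbers.\<close>

definition window_prog :: com where
  "window_prog =
    (let N = ROfNat n_samples; L = RGet 0 (NConst 0); l = ROfNat (nvar 1) in
     While (BAnd (NLess (nvar 1) n_samples)
         (RLess (RTimes (RTimes (ROfNat (NConst 2)) (RTimes L L)) (RTimes (RTimes l l) (RTimes l l)))
           (RTimes (ROfNat (nvar 0)) (RTimes N (RTimes N N)))))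
       (nset 1 (NPlus (nvar 1) (NConst 1))))"

definition factor_prog :: "nat \<Rightarrow> rexp \<Rightarrow> com" where
  "factor_prog v e =
    Cond (RLess e (RGet 1 (nvar 2)))
     (rset v (RTimes (rvar v) (RMinus (ROfNat (NConst 1)) (RDivide (ROfNat (NConst 1)) (ROfNat (nvar 5))))))
     Skip"

text \<open>Both products, at \<open>x\<close> and at \<open>x + l/r\<close>, are built in one pass,
  so each sample's rank is computed once. Equality of bidders is expressed by two negated
  comparisons.\<close>

definition product_limit_prog :: com where
  "product_limit_prog =
    Seq (rset 3 (ROfNat (NConst 1))) (Seq (rset 4 (ROfNat (NConst 1))) (Seq (nset 2 (NConst 0))
     (While (NLess (nvar 2) n_samples)
       (Seq (rank_prog 5 (RGet 1 (nvar 2)))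
        (Seq
          (Cond (BAnd (BNot (NLess (NGet 1 (nvar 2)) (NGet 0 (NConst 2))))
              (BNot (NLess (NGet 0 (NConst 2)) (NGet 1 (nvar 2)))))
            (Seq (factor_prog 3 (RGet 0 (NConst 2))) (factor_prog 4 (rvar 2)))
            Skip)
          (nset 2 (NPlus (nvar 2) (NConst 1))))))))"

definition estimate_prog :: com where
  "estimate_prog =
    Cond (NLess n_samples (NConst threshold)) (rset 0 (ROfNat (NConst 1)))
     (Seq log_bound_prog (Seq window_prog (Seq (rank_prog 4 (RGet 0 (NConst 2)))
       (Cond (RLess (RPlus (RTimes (RGet 0 (NConst 2)) (ROfNat (nvar 4))) (ROfNat (nvar 1))) (ROfNat (nvar 4)))
         (Seq (rset 2 (RPlus (RGet 0 (NConst 2)) (RDivide (ROfNat (nvar 1)) (ROfNat (nvar 4)))))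
           (Seq product_limit_prog
             (rset 0 (RDivide (RMinus (rvar 4) (rvar 3)) (RDivide (ROfNat (nvar 1)) (ROfNat (nvar 4)))))))
         (rset 0 (ROfNat (NConst 1)))))))"

section \<open>Correctness and running time of the program\<close>

context
  fixes k :: nat and L \<delta> :: real and n :: nat and S :: "nat \<Rightarrow> real \<times> nat" and i :: nat and x :: real
begin

text \<open>The program writes only to the two arrays with number 2; every memory it reaches is the
  loaded input with these two replaced.\<close>

definition st :: "(nat \<Rightarrow> nat) \<Rightarrow> (nat \<Rightarrow> real) \<Rightarrow> memory" where
  "st f g = ((fst (load k L \<delta> n S i x))(2 := f), (snd (load k L \<delta> n S i x))(2 := g))"

lemma load_eq_st: "load k L \<delta> n S i x = st (\<lambda>_. 0) (\<lambda>_. 0)"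
  by (simp add: st_def load_def fun_eq_iff)

lemma st_simps [simp]:
  "fst (st f g) 2 = f" "snd (st f g) 2 = g"
  "fst (st f g) 0 0 = n" "fst (st f g) 0 2 = i"
  "j < n \<Longrightarrow> fst (st f g) (Suc 0) j = snd (S j)"
  "snd (st f g) 0 0 = L" "snd (st f g) 0 (Suc 0) = \<delta>" "snd (st f g) 0 2 = x"
  "j < n \<Longrightarrow> snd (st f g) (Suc 0) j = fst (S j)"
  "nstore 2 v a (st f g) = st (f(v := a)) g"
  "rstore 2 v b (st f g) = st f (g(v := b))"
  by (simp_all add: st_def load_def)

text \<open>\<open>e\<close> is evaluated anew in every round, so its value must survive changes of
  the accumulator \<open>v\<close> and of the loop counter 3.\<close>

lemma runs_rank_prog:
  assumes e: "\<And>a b. rval e (st (f(v := a, 3 := b)) g) = y" and v: "v \<noteq> 3"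
  shows "runs (rank_prog v e) (st f g) (5 * n + 3) (\<lambda>s. s = st (f(v := rank n S y, 3 := n)) g)"
proof -
  define I where "I = (\<lambda>j s. s = st (f(v := rank j S y, 3 := j)) g)"
  have "runs (While (NLess (nvar 3) n_samples)
      (Seq (Cond (RLess e (RGet 1 (nvar 3))) Skip (nset v (NPlus (nvar v) (NConst 1))))
        (nset 3 (NPlus (nvar 3) (NConst 1))))) (st (f(v := 0, 3 := 0)) g) (n * Suc (Suc 1 + 1) + 1) (I n)"
  proof (rule runs_While)
    show "I 0 (st (f(v := 0, 3 := 0)) g)" by (simp add: I_def rank_0)
    fix j s assume j: "j < n" and I: "I j s"
    have upd: "f(v := a, 3 := b, v := a') = f(v := a', 3 := b)" for a b a'
      using v by (auto simp: fun_eq_iff)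
    have "runs (Seq (Cond (RLess e (RGet 1 (nvar 3))) Skip (nset v (NPlus (nvar v) (NConst 1))))
        (nset 3 (NPlus (nvar 3) (NConst 1)))) s (Suc 1 + 1) (I (Suc j))"
      unfolding I[unfolded I_def]
      by (intro runs_Seq runs_Cond)
        (use j v in \<open>auto simp: e I_def rank_Suc upd intro!: runs_Skip runs_NAssign\<close>)
    then show "bval (NLess (nvar 3) n_samples) s \<and>
      runs (Seq (Cond (RLess e (RGet 1 (nvar 3))) Skip (nset v (NPlus (nvar v) (NConst 1))))
        (nset 3 (NPlus (nvar 3) (NConst 1)))) s (Suc 1 + 1) (I (Suc j))"
      using I j by (simp add: I_def)
  qed (simp add: I_def)
  then have "runs (rank_prog v e) (st f g) (1 + (1 + (n * Suc (Suc 1 + 1) + 1))) (I n)"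
    unfolding rank_prog_def by (intro runs_Seq runs_NAssign) simp_all
  then show ?thesis by (rule runs_mono) (auto simp: I_def)
qed

lemma log_bound_le: "log_bound \<delta> n \<le> n"
  unfolding log_bound_def by (rule Least_le) simp

lemma window_le: "window L \<delta> n \<le> n"
  unfolding window_def by (rule Least_le) simp

text \<open>The guard is the negation of the condition under \<open>LEAST\<close>, so the loop makes
  exactly \<open>log_bound \<delta> n\<close> rounds. The final power of two is left unspecified, as
  nothing reads it later.\<close>

lemma runs_log_bound_prog:
  "runs log_bound_prog (st (\<lambda>_. 0) (\<lambda>_. 0)) (3 * n + 2)
    (\<lambda>s. \<exists>b. s = st ((\<lambda>_. 0)(0 := log_bound \<delta> n)) ((\<lambda>_. 0)(1 := b)))"
proof -
  define N where "N = log_bound \<delta> n"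
  define I where "I = (\<lambda>j s. s = st ((\<lambda>_. 0)(0 := j)) ((\<lambda>_. 0)(1 := 2 ^ j)))"
  let ?b = "BAnd (NLess (nvar 0) n_samples)
      (RLess (RTimes (rvar 1) (RGet 0 (NConst 1))) (RTimes (ROfNat (NConst 4)) (ROfNat n_samples)))"
  let ?c = "Seq (nset 0 (NPlus (nvar 0) (NConst 1))) (rset 1 (RPlus (rvar 1) (rvar 1)))"
  have N: "N = n \<or> 4 * real n \<le> 2 ^ N * \<delta>"
    unfolding N_def log_bound_def by (rule LeastI[of _ n]) simp
  have below: "j \<noteq> n" "2 ^ j * \<delta> < 4 * real n" if "j < N" for j
    using not_less_Least[OF that[unfolded N_def log_bound_def]] by auto
  have "N \<le> n" unfolding N_def by (rule log_bound_le)
  have "runs (While ?b ?c) (st (\<lambda>_. 0) ((\<lambda>_. 0)(1 := 1))) (N * Suc (1 + 1) + 1) (I N)"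
  proof (rule runs_While)
    show "I 0 (st (\<lambda>_. 0) ((\<lambda>_. 0)(1 := 1)))" by (simp add: I_def fun_upd_idem)
    fix j s assume j: "j < N" and I: "I j s"
    have "runs ?c s (1 + 1) (I (Suc j))"
      unfolding I[unfolded I_def] by (intro runs_Seq runs_NAssign runs_RAssign) (simp_all add: I_def)
    then show "bval ?b s \<and> runs ?c s (1 + 1) (I (Suc j))"
      using I j below(2)[OF j] \<open>N \<le> n\<close> by (simp add: I_def)
  next
    fix s assume "I N s"
    then show "\<not> bval ?b s" using N \<open>N \<le> n\<close> by (auto simp: I_def)
  qed
  then have "runs log_bound_prog (st (\<lambda>_. 0) (\<lambda>_. 0)) (1 + (N * Suc (1 + 1) + 1)) (I N)"
    unfolding log_bound_prog_def by (intro runs_Seq runs_RAssign) simp_all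
  then show ?thesis by (rule runs_mono) (use \<open>N \<le> n\<close> in \<open>auto simp: I_def N_def\<close>)
qed

lemma runs_window_prog:
  assumes "f 0 = log_bound \<delta> n" "f 1 = 0"
  shows "runs window_prog (st f g) (2 * n + 1) (\<lambda>s. s = st (f(1 := window L \<delta> n)) g)"
proof -
  define N where "N = window L \<delta> n"
  define I where "I = (\<lambda>j s. s = st (f(1 := j)) g)"
  have N: "N = n \<or> real (log_bound \<delta> n) * real n ^ 3 \<le> 2 * L\<^sup>2 * real N ^ 4"
    unfolding N_def window_def by (rule LeastI[of _ n]) simp
  have below: "2 * L\<^sup>2 * real j ^ 4 < real (log_bound \<delta> n) * real n ^ 3" if "j < N" for j
    using not_less_Least[OF that[unfolded N_def window_def]] by auto
  have "N \<le> n" unfolding N_def by (rule window_le)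
  have arith: "2 * (L * L) * (a * a * (a * a)) = 2 * L\<^sup>2 * a ^ 4" "b * (c * (c * c)) = b * c ^ 3" for a b c :: real
    by (simp_all add: power2_eq_square power3_eq_cube power4_eq_xxxx)
  have "runs window_prog (st f g) (N * Suc 1 + 1) (I N)"
    unfolding window_prog_def Let_def
  proof (rule runs_While)
    show "I 0 (st f g)" using assms by (simp add: I_def fun_upd_idem)
    fix j s assume j: "j < N" and I: "I j s"
    show "bval (BAnd (NLess (nvar 1) n_samples)
         (RLess (RTimes (RTimes (ROfNat (NConst 2)) (RTimes (RGet 0 (NConst 0)) (RGet 0 (NConst 0))))
             (RTimes (RTimes (ROfNat (nvar 1)) (ROfNat (nvar 1))) (RTimes (ROfNat (nvar 1)) (ROfNat (nvar 1)))))
           (RTimes (ROfNat (nvar 0)) (RTimes (ROfNat n_samples) (RTimes (ROfNat n_samples) (ROfNat n_samples)))))) s \<and>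
      runs (nset 1 (NPlus (nvar 1) (NConst 1))) s 1 (I (Suc j))"
      using I j below[OF j] \<open>N \<le> n\<close> assms by (auto simp: I_def arith intro!: runs_NAssign)
  next
    fix s assume "I N s"
    then show "\<not> bval (BAnd (NLess (nvar 1) n_samples)
         (RLess (RTimes (RTimes (ROfNat (NConst 2)) (RTimes (RGet 0 (NConst 0)) (RGet 0 (NConst 0))))
             (RTimes (RTimes (ROfNat (nvar 1)) (ROfNat (nvar 1))) (RTimes (ROfNat (nvar 1)) (ROfNat (nvar 1)))))
           (RTimes (ROfNat (nvar 0)) (RTimes (ROfNat n_samples) (RTimes (ROfNat n_samples) (ROfNat n_samples)))))) s"
      using N \<open>N \<le> n\<close> assms by (auto simp: I_def arith)
  qed
  then show ?thesis by (rule runs_mono) (use \<open>N \<le> n\<close> in \<open>auto simp: I_def N_def\<close>)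
qed

lemma runs_factor_prog:
  assumes "rval e (st f g) = y" "f 2 < n"
  shows "runs (factor_prog v e) (st f g) 2
    (\<lambda>s. s = st f (g(v := g v * (if y < fst (S (f 2)) then 1 - 1 / real (f 5) else 1))))"
proof -
  have "runs (factor_prog v e) (st f g) (Suc 1)
    (\<lambda>s. s = st f (g(v := g v * (if y < fst (S (f 2)) then 1 - 1 / real (f 5) else 1))))"
    unfolding factor_prog_def
    by (intro runs_Cond) (use assms in \<open>auto simp: intro!: runs_Skip runs_RAssign\<close>)
  then show ?thesis by (simp add: numeral_2_eq_2)
qed

lemma runs_product_limit_prog:
  "runs product_limit_prog (st f g) (5 * n * n + 20 * n + 10)
    (\<lambda>s. \<exists>a b. s = st (f(2 := n, 3 := a, 5 := b))
      (g(3 := product_limit n S i x, 4 := product_limit n S i (g 2))))"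
proof -
  \<comment> \<open>Partial products over the first \<open>m\<close> samples, with the ranks already
    taken among all \<open>n\<close> samples.\<close>
  define pl where "pl = (\<lambda>m y. \<Prod>j<m. if snd (S j) = i \<and> y < fst (S j)
      then 1 - 1 / real (rank n S (fst (S j))) else 1)"
  \<comment> \<open>Variables 3 and 5 are scratch space of the rank computation, so the invariant
    leaves their values open.\<close>
  define I where "I = (\<lambda>j s. \<exists>a b. s = st (f(2 := j, 3 := a, 5 := b)) (g(3 := pl j x, 4 := pl j (g 2))))"
  let ?eq = "BAnd (BNot (NLess (NGet 1 (nvar 2)) (NGet 0 (NConst 2))))
      (BNot (NLess (NGet 0 (NConst 2)) (NGet 1 (nvar 2))))"
  let ?d = "Seq (Cond ?eq (Seq (factor_prog 3 (RGet 0 (NConst 2))) (factor_prog 4 (rvar 2))) Skip)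
      (nset 2 (NPlus (nvar 2) (NConst 1)))"
  let ?c = "Seq (rank_prog 5 (RGet 1 (nvar 2))) ?d"
  have "runs (While (NLess (nvar 2) n_samples) ?c) (st (f(2 := 0)) (g(3 := 1, 4 := 1)))
      (n * Suc ((5 * n + 3) + (Suc (2 + 2) + 1)) + 1) (I n)"
  proof (rule runs_While)
    have upd: "f(2 := 0, 3 := f 3, 5 := f 5) = f(2 := 0)" by (auto simp: fun_eq_iff)
    show "I 0 (st (f(2 := 0)) (g(3 := 1, 4 := 1)))"
      unfolding I_def
      by (intro exI[of _ "f 3"] exI[of _ "f 5"]) (simp only: upd pl_def lessThan_0 prod.empty)
  next
    fix j s assume j: "j < n" and "I j s"
    then obtain a b where s: "s = st (f(2 := j, 3 := a, 5 := b)) (g(3 := pl j x, 4 := pl j (g 2)))"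
      unfolding I_def by blast
    define R where "R = rank n S (fst (S j))"
    define f' where "f' = f(2 := j, 3 := n, 5 := R)"
    have f': "f' 2 = j" "f' 5 = R" "f'(2 := Suc j) = f(2 := Suc j, 3 := n, 5 := R)"
      by (auto simp: f'_def fun_eq_iff)
    have I_Suc: "I (Suc j) (st (f'(2 := Suc j)) g')" if "g' = g(3 := pl (Suc j) x, 4 := pl (Suc j) (g 2))" for g'
      unfolding I_def f'(3) that by blast
    have pl_Suc: "pl (Suc j) y = pl j y * (if snd (S j) = i \<and> y < fst (S j) then 1 - 1 / real R else 1)" for y
      by (simp add: pl_def R_def)
    have g2: "(g(3 := c, 4 := d)) 2 = g 2" for c d by simp
    have "runs ?d (st f' (g(3 := pl j x, 4 := pl j (g 2)))) (Suc (2 + 2) + 1) (I (Suc j))"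
    proof (intro runs_Seq runs_Cond)
      assume "bval ?eq (st f' (g(3 := pl j x, 4 := pl j (g 2))))"
      then have Z: "snd (S j) = i" using f' j by auto
      show "runs (factor_prog 3 (RGet 0 (NConst 2))) (st f' (g(3 := pl j x, 4 := pl j (g 2)))) 2
        (\<lambda>s'. runs (factor_prog 4 (rvar 2)) s' 2 (\<lambda>s'. runs (nset 2 (NPlus (nvar 2) (NConst 1))) s' 1 (I (Suc j))))"
      proof (rule runs_mono[OF runs_factor_prog[where y = x]])
        fix s' assume s': "s' = st f' ((g(3 := pl j x, 4 := pl j (g 2)))
            (3 := (g(3 := pl j x, 4 := pl j (g 2))) 3 * (if x < fst (S (f' 2)) then 1 - 1 / real (f' 5) else 1)))"
        have s'': "s' = st f' (g(3 := pl (Suc j) x, 4 := pl j (g 2)))"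
          unfolding s'
            by (rule arg_cong[where f = "st f'"]) (use Z f'(1,2) in \<open>auto simp: pl_Suc fun_eq_iff\<close>)
        show "runs (factor_prog 4 (rvar 2)) s' 2 (\<lambda>s'. runs (nset 2 (NPlus (nvar 2) (NConst 1))) s' 1 (I (Suc j)))"
          unfolding s''
        proof (rule runs_mono[OF runs_factor_prog[where y = "g 2"]])
          fix s assume s: "s = st f' ((g(3 := pl (Suc j) x, 4 := pl j (g 2)))
            (4 := (g(3 := pl (Suc j) x, 4 := pl j (g 2))) 4 * (if g 2 < fst (S (f' 2)) then 1 - 1 / real (f' 5) else 1)))"
          have s_eq: "s = st f' (g(3 := pl (Suc j) x, 4 := pl (Suc j) (g 2)))"
            unfolding s
            by (rule arg_cong[where f = "st f'"]) (use Z f'(1,2) in \<open>auto simp: pl_Suc fun_eq_iff\<close>)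
          show "runs (nset 2 (NPlus (nvar 2) (NConst 1))) s 1 (I (Suc j))"
            unfolding s_eq by (intro runs_NAssign) (use f'(1,2) in \<open>simp_all add: I_Suc\<close>)
        qed (use f'(1,2) j in auto)
      qed (use f'(1,2) j in auto)
    next
      assume "\<not> bval ?eq (st f' (g(3 := pl j x, 4 := pl j (g 2))))"
      then have Z: "snd (S j) \<noteq> i" using f' j by auto
      have "runs Skip (st f' (g(3 := pl j x, 4 := pl j (g 2)))) 1
        (\<lambda>s'. runs (nset 2 (NPlus (nvar 2) (NConst 1))) s' 1 (I (Suc j)))"
        by (intro runs_Skip runs_NAssign) (use f'(1,2) Z in \<open>simp_all add: I_Suc pl_Suc\<close>)
      then show "runs Skip (st f' (g(3 := pl j x, 4 := pl j (g 2)))) (2 + 2)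
        (\<lambda>s'. runs (nset 2 (NPlus (nvar 2) (NConst 1))) s' 1 (I (Suc j)))"
        by (rule runs_mono) auto
    qed
    moreover have upd: "f(2 := j, 3 := a, 5 := b, 5 := R, 3 := n) = f'"
      by (auto simp: f'_def fun_eq_iff)
    have "runs (rank_prog 5 (RGet 1 (nvar 2))) s (5 * n + 3)
        (\<lambda>s'. s' = st f' (g(3 := pl j x, 4 := pl j (g 2))))"
      unfolding s upd[symmetric] R_def by (rule runs_rank_prog) (use j in auto)
    ultimately have "runs ?c s ((5 * n + 3) + (Suc (2 + 2) + 1)) (I (Suc j))"
      by (intro runs_Seq) (auto elim!: runs_mono)
    then show "bval (NLess (nvar 2) n_samples) s \<and> runs ?c s ((5 * n + 3) + (Suc (2 + 2) + 1)) (I (Suc j))"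
      using j by (simp add: s)
  next
    fix s assume "I n s"
    then show "\<not> bval (NLess (nvar 2) n_samples) s" by (auto simp: I_def)
  qed
  then have "runs product_limit_prog (st f g)
      (1 + (1 + (1 + (n * Suc ((5 * n + 3) + (Suc (2 + 2) + 1)) + 1)))) (I n)"
    unfolding product_limit_prog_def by (intro runs_Seq runs_RAssign runs_NAssign) simp_all
  then show ?thesis
    by (rule runs_mono) (auto simp: I_def pl_def product_limit_def algebra_simps)
qed

lemma runs_estimate_prog:
  "runs estimate_prog (st (\<lambda>_. 0) (\<lambda>_. 0)) (5 * n * n + 50 * n + 50)
    (\<lambda>s. result s = density_estimate k L \<delta> n S i x)"
proof -
  define l where "l = window L \<delta> n"
  define r where "r = rank n S x"
  define l0 where "l0 = log_bound \<delta> n"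
  let ?Q = "\<lambda>s. result s = density_estimate k L \<delta> n S i x"
  have one: "runs (rset 0 (ROfNat (NConst 1))) (st f g) 1 ?Q"
    if "\<not> (threshold \<le> n \<and> x * real r + real l < real r)" for f g
    using that by (intro runs_RAssign) (auto simp: result_def density_estimate_def Let_def l_def r_def)
  have final: "runs
      (Cond (RLess (RPlus (RTimes (RGet 0 (NConst 2)) (ROfNat (nvar 4))) (ROfNat (nvar 1))) (ROfNat (nvar 4)))
         (Seq (rset 2 (RPlus (RGet 0 (NConst 2)) (RDivide (ROfNat (nvar 1)) (ROfNat (nvar 4)))))
           (Seq product_limit_prog
             (rset 0 (RDivide (RMinus (rvar 4) (rvar 3)) (RDivide (ROfNat (nvar 1)) (ROfNat (nvar 4)))))))
         (rset 0 (ROfNat (NConst 1)))) (st f g) (Suc (1 + ((5 * n * n + 20 * n + 10) + 1))) ?Q"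
    if f: "f 1 = l" "f 4 = r" and "threshold \<le> n" for f g
  proof (intro runs_Cond)
    assume "bval (RLess (RPlus (RTimes (RGet 0 (NConst 2)) (ROfNat (nvar 4))) (ROfNat (nvar 1))) (ROfNat (nvar 4))) (st f g)"
    then have c: "x * real r + real l < real r" using f by simp
    show "runs (Seq (rset 2 (RPlus (RGet 0 (NConst 2)) (RDivide (ROfNat (nvar 1)) (ROfNat (nvar 4)))))
           (Seq product_limit_prog
             (rset 0 (RDivide (RMinus (rvar 4) (rvar 3)) (RDivide (ROfNat (nvar 1)) (ROfNat (nvar 4)))))))
        (st f g) (1 + ((5 * n * n + 20 * n + 10) + 1)) ?Q"
    proof (intro runs_Seq runs_RAssign, simp only: st_simps nval.simps, rule runs_mono[OF runs_product_limit_prog order_refl])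
      fix s
      assume "\<exists>a b. s = st (f(2 := n, 3 := a, 5 := b))
        ((g(2 := rval (RPlus (RGet 0 (NConst 2)) (RDivide (ROfNat (nvar 1)) (ROfNat (nvar 4)))) (st f g)))
          (3 := product_limit n S i x, 4 := product_limit n S i
            ((g(2 := rval (RPlus (RGet 0 (NConst 2)) (RDivide (ROfNat (nvar 1)) (ROfNat (nvar 4)))) (st f g))) 2)))"
      then show "runs (rset 0 (RDivide (RMinus (rvar 4) (rvar 3)) (RDivide (ROfNat (nvar 1)) (ROfNat (nvar 4))))) s 1 ?Q"
        using f c \<open>threshold \<le> n\<close>
        by (intro runs_RAssign) (auto simp: result_def density_estimate_def Let_def l_def r_def)
    qed simp
  next
    assume "\<not> bval (RLess (RPlus (RTimes (RGet 0 (NConst 2)) (ROfNat (nvar 4))) (ROfNat (nvar 1))) (ROfNat (nvar 4))) (st f g)"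
    then have c: "\<not> x * real r + real l < real r" using f by simp
    show "runs (rset 0 (ROfNat (NConst 1))) (st f g) (1 + ((5 * n * n + 20 * n + 10) + 1)) ?Q"
      by (rule runs_mono[OF one]) (use c in auto)
  qed
  have "runs estimate_prog (st (\<lambda>_. 0) (\<lambda>_. 0))
     (Suc ((3 * n + 2) + ((2 * n + 1) + ((5 * n + 3) + (Suc (1 + ((5 * n * n + 20 * n + 10) + 1))))))) ?Q"
    unfolding estimate_prog_def
  proof (intro runs_Cond)
    assume "bval (NLess n_samples (NConst threshold)) (st (\<lambda>_. 0) (\<lambda>_. 0))"
    then have "\<not> threshold \<le> n" by simp
    then show "runs (rset 0 (ROfNat (NConst 1))) (st (\<lambda>_. 0) (\<lambda>_. 0))
      ((3 * n + 2) + ((2 * n + 1) + ((5 * n + 3) + (Suc (1 + ((5 * n * n + 20 * n + 10) + 1)))))) ?Q"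
      by (intro runs_mono[OF one]) auto
  next
    assume "\<not> bval (NLess n_samples (NConst threshold)) (st (\<lambda>_. 0) (\<lambda>_. 0))"
    then have thr: "threshold \<le> n" by simp
    show "runs (Seq log_bound_prog (Seq window_prog (Seq (rank_prog 4 (RGet 0 (NConst 2)))
       (Cond (RLess (RPlus (RTimes (RGet 0 (NConst 2)) (ROfNat (nvar 4))) (ROfNat (nvar 1))) (ROfNat (nvar 4)))
         (Seq (rset 2 (RPlus (RGet 0 (NConst 2)) (RDivide (ROfNat (nvar 1)) (ROfNat (nvar 4)))))
           (Seq product_limit_prog
             (rset 0 (RDivide (RMinus (rvar 4) (rvar 3)) (RDivide (ROfNat (nvar 1)) (ROfNat (nvar 4)))))))
         (rset 0 (ROfNat (NConst 1))))))) (st (\<lambda>_. 0) (\<lambda>_. 0))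
      ((3 * n + 2) + ((2 * n + 1) + ((5 * n + 3) + (Suc (1 + ((5 * n * n + 20 * n + 10) + 1)))))) ?Q"
      apply (rule runs_Seq, rule runs_mono[OF runs_log_bound_prog order_refl], erule exE, hypsubst)
      apply (rule runs_Seq, rule runs_mono[OF runs_window_prog order_refl], simp, simp, hypsubst)
      apply (rule runs_Seq, rule runs_mono[OF runs_rank_prog[where y = x] order_refl], simp, simp, hypsubst)
      apply (rule final)
      using thr apply (simp_all add: l_def r_def)
      done
  qed
  then show ?thesis by (rule runs_mono) auto
qed

end

lemma estimate_prog_poly_time: "computes_in_poly_time estimate_prog density_estimate"
  unfolding computes_in_poly_time_def
proof (intro exI[of _ "[:50, 50, 5:]"] allI impI)
  fix k L \<delta> n S i x
  show "\<exists>t s. exec estimate_prog (load k L \<delta> n S i x) t s \<and> t \<le> poly [:50, 50, 5:] n \<and>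
      result s = density_estimate k L \<delta> n S i x"
    using runs_estimate_prog[where k = k and L = L and \<delta> = \<delta> and n = n and S = S and i = i and x = x,
        folded load_eq_st]
    by (auto simp: runs_def algebra_simps)
qed


section \<open>The number of samples\<close>

text \<open>Turns a logarithm of \<phi> into a logarithm of \<open>n\<close>. If
  \<open>n \<le> \<phi> ^ 4\<close>, then \<open>ln n \<le> 4 * ln \<phi>\<close> and the hypothesis
  applies. Otherwise \<phi> is below the fourth root \<open>w\<close> of \<open>n\<close>, and
  \<open>ln n = 4 * ln w \<le> 4 * w\<close> bounds the product by four times the square root of
  \<open>n\<close>, negligible against \<open>n\<close>.\<close>

lemma phi_ln_bound:
  fixes \<phi> :: real
  assumes n: "10 ^ 20 \<le> real n" and "0 < \<phi>" and hyp: "10 ^ 20 * \<phi> * ln \<phi> \<le> real n"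
  shows "\<phi> * ln (real n) \<le> real n / 10 ^ 9"
proof (cases "real n \<le> \<phi> ^ 4")
  case True
  have "(1 :: real) \<le> 10 ^ 20" by simp
  then have "1 \<le> \<phi> ^ 4" using True n by (meson order_trans)
  then have "1 \<le> \<phi>" using \<open>0 < \<phi>\<close> by (metis less_imp_le not_le power_less_one_iff zero_less_numeral)
  have "ln (real n) \<le> ln (\<phi> ^ 4)" using True n by (intro ln_mono) auto
  then have "ln (real n) \<le> 4 * ln \<phi>" using \<open>0 < \<phi>\<close> by (simp add: ln_realpow)
  then have "\<phi> * ln (real n) \<le> \<phi> * (4 * ln \<phi>)" using \<open>0 < \<phi>\<close> by (intro mult_left_mono) auto
  with hyp show ?thesis by (simp add: algebra_simps)
next
  case False
  define w where "w = sqrt (sqrt (real n))"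
  have w0: "0 < w" using n by (simp add: w_def)
  have w2: "w\<^sup>2 = sqrt (real n)" by (simp add: w_def)
  have "w ^ 4 = (w\<^sup>2)\<^sup>2" by simp
  then have w4: "w ^ 4 = real n" unfolding w2 by simp
  have "sqrt (10 ^ 20) \<le> w\<^sup>2" unfolding w2 using n by (intro real_sqrt_le_mono)
  moreover have "sqrt (10 ^ 20) = 10 ^ 10" by (rule real_sqrt_unique) auto
  ultimately have w2_large: "10 ^ 10 \<le> w\<^sup>2" by simp
  have "\<phi> \<le> w" using False w4 w0 power_mono[of w \<phi> 4] by fastforce
  moreover have "ln (real n) \<le> 4 * w"
    using w0 ln_le_minus_one[OF w0] by (simp add: w4[symmetric] ln_realpow)
  moreover have "0 \<le> ln (real n)" using n by (intro ln_ge_zero) simp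
  ultimately have "\<phi> * ln (real n) \<le> w * (4 * w)" using w0 by (intro mult_mono) auto
  also have "\<dots> = 4 * w\<^sup>2" by (simp add: power2_eq_square)
  also have "\<dots> \<le> w\<^sup>2 / 10 ^ 9 * w\<^sup>2"
    using w2_large by (intro mult_right_mono) auto
  also have "\<dots> = w ^ 4 / 10 ^ 9" by (simp add: power2_eq_square power4_eq_xxxx)
  finally show ?thesis by (simp add: w4)
qed

text \<open>By minimality the predecessor violates the defining inequality, so
  \<open>2 ^ m * \<delta> \<le> 8 * n\<close>. After taking logarithms, the lower bound 2/3 for both
  \<open>ln 2\<close> and \<Lambda> merges all terms into one multiple of
  \<open>\<Lambda> * ln n\<close>.\<close>

lemma log_bound_upper:
  assumes n: "10 ^ 20 \<le> real n" and \<delta>: "0 < \<delta>" "\<delta> < 1"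
    and \<Lambda>: "ln (1 / \<delta>) \<le> \<Lambda>" "ln 2 \<le> \<Lambda>"
  shows "real (log_bound \<delta> n) \<le> 6 * \<Lambda> * ln (real n)"
proof -
  define m where "m = log_bound \<delta> n"
  have "2 ^ m * \<delta> \<le> 8 * real n"
  proof (cases m)
    case (Suc m')
    then have "m' < (LEAST m. m = n \<or> 4 * real n \<le> 2 ^ m * \<delta>)"
      unfolding log_bound_def[symmetric] using m_def by simp
    from not_less_Least[OF this] have "2 ^ m' * \<delta> \<le> 4 * real n" by linarith
    then show ?thesis by (simp add: Suc mult.commute)
  qed (use n \<delta> in simp)
  then have "ln (2 ^ m * \<delta>) \<le> ln (8 * real n)" using n \<delta> by (intro ln_mono) auto
  then have "real m * ln 2 \<le> ln 8 + ln (real n) + ln (1 / \<delta>)"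
    using n \<delta> by (simp add: ln_mult ln_realpow ln_div)
  moreover have "ln 8 \<le> ln (real n)" using n by (intro ln_mono) auto
  moreover have ln1: "1 \<le> ln (real n)"
  proof -
    have "exp (1::real) \<le> 3" by (rule exp_le)
    then show ?thesis using n by (subst ln_ge_iff) auto
  qed
  moreover have \<Lambda>': "2 / 3 \<le> \<Lambda>" using ln2_ge_two_thirds \<Lambda> by simp
  then have "2 * ln (real n) \<le> 3 * \<Lambda> * ln (real n)" using ln1 by (intro mult_right_mono) auto
  moreover have "\<Lambda> * 1 \<le> \<Lambda> * ln (real n)" using ln1 \<Lambda>' by (intro mult_left_mono) auto
  ultimately have "real m * ln 2 \<le> 4 * (\<Lambda> * ln (real n))" using \<Lambda> by linarith
  moreover have "real m * (2 / 3) \<le> real m * ln 2" using ln2_ge_two_thirds by (intro mult_left_mono) auto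
  ultimately show ?thesis unfolding m_def by linarith
qed

text \<open>With \<open>b = window / n\<close> and \<open>v = \<gamma> * \<epsilon>\<close>, this is
  where the sample size becomes accuracy: the final error is \<open>40 * (L * b) / \<gamma>\<close>.
  The bound \<open>v / 40\<close> consists of \<open>v / 80\<close> for the predecessor of the
  window, by minimality, and \<open>v / 80\<close> for the rounding by one unit.\<close>

lemma window_small:
  assumes n: "threshold \<le> n" and L: "0 < L" and \<delta>: "0 < \<delta>" "\<delta> < 1" and v: "0 < v" "v \<le> 1 / 2"
    and \<Lambda>: "ln (1 / \<delta>) \<le> \<Lambda>" "ln 2 \<le> \<Lambda>"
    and \<phi>: "\<phi> = L\<^sup>2 * \<Lambda> / v ^ 4" and hyp: "10 ^ 20 * \<phi> * ln \<phi> \<le> real n"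
  shows "40 * (L * (real (window L \<delta> n) / real n)) \<le> v"
proof -
  define l where "l = window L \<delta> n"
  define N where "N = real n"
  \<comment> \<open>Natural subtraction makes this 0 for an empty window, where nothing is to be
    shown.\<close>
  define c where "c = real (l - 1) / N"
  have "real threshold \<le> real n" using n by (simp only: of_nat_le_iff)
  then have N: "10 ^ 20 \<le> real n" "10 ^ 20 \<le> N" "0 < N" unfolding threshold_def N_def by simp_all
  have \<Lambda>': "2 / 3 \<le> \<Lambda>" using ln2_ge_two_thirds \<Lambda> by simp
  have \<phi>0: "0 < \<phi>" unfolding \<phi> using L \<Lambda>' v by (intro divide_pos_pos mult_pos_pos) auto
  have \<phi>v: "L\<^sup>2 * \<Lambda> = \<phi> * v ^ 4" using v by (simp add: \<phi>)
  have \<phi>ln: "\<phi> * ln N \<le> N / 10 ^ 9" using phi_ln_bound[OF N(1) \<phi>0 hyp] by (simp add: N_def)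
  have "1 \<le> ln N" using N exp_le by (subst ln_ge_iff) auto
  then have "\<phi> * 1 \<le> \<phi> * ln N" using \<phi>0 by (intro mult_left_mono) auto
  then have \<phi>N: "\<phi> \<le> N / 10 ^ 9" using \<phi>ln by linarith
  have v42: "v ^ 4 \<le> v\<^sup>2" using v by (intro power_decreasing) auto
  have Lc: "L * c \<le> v / 80"
  proof (cases l)
    case 0
    then show ?thesis using v by (simp add: c_def)
  next
    case (Suc l')
    then have "l' < (LEAST l. l = n \<or> real (log_bound \<delta> n) * real n ^ 3 \<le> 2 * L\<^sup>2 * real l ^ 4)"
      unfolding window_def[symmetric] using l_def by simp
    from not_less_Least[OF this] have "2 * L\<^sup>2 * real l' ^ 4 \<le> real (log_bound \<delta> n) * N ^ 3"
      by (simp add: N_def)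
    also have "\<dots> \<le> (6 * \<Lambda> * ln N) * N ^ 3"
      using log_bound_upper[OF N(1) \<delta> \<Lambda>] N by (intro mult_right_mono) (auto simp: N_def)
    finally have "L\<^sup>2 * (2 * L\<^sup>2 * real l' ^ 4) \<le> L\<^sup>2 * ((6 * \<Lambda> * ln N) * N ^ 3)"
      using L by (intro mult_left_mono) auto
    also have "\<dots> = 6 * (L\<^sup>2 * \<Lambda>) * ln N * N ^ 3" by (simp add: mult_ac)
    also have "\<dots> = 6 * (\<phi> * ln N) * (v ^ 4 * N ^ 3)" unfolding \<phi>v by (simp add: mult_ac)
    also have "\<dots> \<le> 6 * (N / 10 ^ 9) * (v ^ 4 * N ^ 3)"
      using \<phi>ln v N by (intro mult_right_mono mult_left_mono) auto
    finally have "(L * real l') ^ 4 \<le> 3 / 10 ^ 9 * (v * N) ^ 4"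
      by (simp add: power_mult_distrib power2_eq_square power3_eq_cube power4_eq_xxxx mult_ac)
    \<comment> \<open>The fourth power of 80 is about 4.1 times \<open>10 ^ 7\<close>, which the
      saving of \<open>10 ^ 9\<close> from \<open>phi_ln_bound\<close> more than covers.\<close>
    also have "\<dots> \<le> 1 / 80 ^ 4 * (v * N) ^ 4"
      by (intro mult_right_mono) auto
    also have "\<dots> = (v * N / 80) ^ 4" by (simp add: power_divide)
    finally have "(L * real l') ^ 4 \<le> (v * N / 80) ^ 4" .
    moreover have "0 \<le> L * real l'" "0 \<le> v * N / 80" using L v N by auto
    ultimately have "L * real l' \<le> v * N / 80"
      using power_mono_iff[of "L * real l'" "v * N / 80" 4] by simp
    then show ?thesis using N Suc by (simp add: c_def field_simps)
  qed
  have "L / N \<le> v / 80"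
  proof (rule power2_le_imp_le)
    have "L\<^sup>2 * (2 / 3) \<le> L\<^sup>2 * \<Lambda>" using \<Lambda>' by (intro mult_left_mono) auto
    also have "\<dots> \<le> N / 10 ^ 9 * v\<^sup>2" unfolding \<phi>v using \<phi>N v42 \<phi>0 v N by (intro mult_mono) auto
    finally have "L\<^sup>2 * (2 / 3) \<le> N * v\<^sup>2 / 10 ^ 9" by simp
    moreover have "0 \<le> N * v\<^sup>2" using N by simp
    ultimately have "L\<^sup>2 \<le> N * v\<^sup>2 / 10 ^ 8" by simp
    then have "L\<^sup>2 / N\<^sup>2 \<le> N * v\<^sup>2 / 10 ^ 8 / N\<^sup>2" by (intro divide_right_mono) auto
    also have "\<dots> = v\<^sup>2 * (1 / (10 ^ 8 * N))" using N by (simp add: power2_eq_square)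
    also have "\<dots> \<le> v\<^sup>2 * (1 / 80\<^sup>2)" using N by (intro mult_left_mono divide_left_mono) auto
    finally show "(L / N)\<^sup>2 \<le> (v / 80)\<^sup>2" by (simp add: power_divide)
  qed (use v in simp)
  moreover have "real l / N \<le> c + 1 / N" using N by (simp add: c_def field_simps)
  then have "L * (real l / N) \<le> L * (c + 1 / N)" using L by (intro mult_left_mono) auto
  moreover have "L * (c + 1 / N) = L * c + L / N" by (simp add: algebra_simps)
  ultimately show ?thesis using Lc by (simp add: l_def N_def)
qed

text \<open>The sample bound says nothing about \<open>n\<close> when \<open>ln \<phi>\<close> is
  not positive, so small \<open>n\<close> has to be treated. If \<phi> exceeded 2, the bound would
  push \<open>n\<close> above the threshold; hence \<open>\<phi> \<le> 2\<close>, and the square of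
  \<open>L\<close> is at most \<open>3 * v ^ 4\<close>.\<close>

lemma small_sample:
  assumes "n < threshold" and L: "0 < L" and v: "0 < v" "v \<le> 1 / 2"
    and \<Lambda>: "ln 2 \<le> \<Lambda>" and \<phi>: "\<phi> = L\<^sup>2 * \<Lambda> / v ^ 4" and hyp: "10 ^ 20 * \<phi> * ln \<phi> \<le> real n"
  shows "L \<le> v"
proof -
  have "real n < real threshold" using assms(1) by (simp only: of_nat_less_iff)
  then have n: "real n < 10 ^ 20" unfolding threshold_def by simp
  have \<Lambda>': "2 / 3 \<le> \<Lambda>" using ln2_ge_two_thirds \<Lambda> by simp
  have "\<phi> \<le> 2"
  proof (rule ccontr)
    assume "\<not> \<phi> \<le> 2"
    then have "ln 2 \<le> ln \<phi>" by (intro ln_mono) auto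
    then have "2 / 3 \<le> ln \<phi>" using ln2_ge_two_thirds by simp
    then have "2 * (2 / 3) \<le> \<phi> * ln \<phi>" using \<open>\<not> \<phi> \<le> 2\<close> by (intro mult_mono) auto
    then show False using hyp n by simp
  qed
  then have "L\<^sup>2 * \<Lambda> \<le> 2 * v ^ 4" using v by (simp add: \<phi> divide_le_eq)
  moreover have "L\<^sup>2 * (2 / 3) \<le> L\<^sup>2 * \<Lambda>" using \<Lambda>' by (intro mult_left_mono) auto
  ultimately have "L\<^sup>2 \<le> 3 * v\<^sup>2 * v\<^sup>2" by (simp add: power2_eq_square power4_eq_xxxx)
  also have "\<dots> \<le> 1 * v\<^sup>2"
  proof (intro mult_right_mono)
    have "v\<^sup>2 \<le> (1 / 2)\<^sup>2" using v by (intro power_mono) auto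
    then show "3 * v\<^sup>2 \<le> 1" by (simp add: power2_eq_square)
  qed simp
  finally show ?thesis using v by (intro power2_le_imp_le[of L v]) auto
qed


section \<open>The estimation error\<close>

text \<open>A crude bound, used only for integrability: the difference of two values in the unit
  interval is multiplied by \<open>r / l\<close>, at most \<open>n\<close>. For \<open>l = 0\<close>
  the quotient is 0 by convention.\<close>

lemma density_estimate_bound: "\<bar>density_estimate k L \<delta> n S i x\<bar> \<le> real n + 1"
proof -
  define l where "l = window L \<delta> n"
  define r where "r = rank n S x"
  have "\<bar>(product_limit n S i (x + real l / real r) - product_limit n S i x) / (real l / real r)\<bar> \<le> real n"
  proof -
    have "\<bar>product_limit n S i (x + real l / real r) - product_limit n S i x\<bar> \<le> 1"
      using product_limit_bounds[of n S i "x + real l / real r"] product_limit_bounds[of n S i x] by auto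
    then have "\<bar>product_limit n S i (x + real l / real r) - product_limit n S i x\<bar> * (real r / real l) \<le> 1 * (real r / real l)"
      by (intro mult_right_mono) auto
    also have "real r / real l \<le> real n"
    proof (cases "l = 0")
      case False
      then have "real r / real l \<le> real r / 1" by (intro divide_left_mono) auto
      also have "\<dots> \<le> real n" using rank_le[of n S x] by (simp add: r_def)
      finally show ?thesis .
    qed simp
    finally show ?thesis by (simp add: abs_mult abs_divide)
  qed
  then show ?thesis unfolding density_estimate_def Let_def l_def[symmetric] r_def[symmetric] by auto
qed

lemma integrable_indicator_Icc: "integrable lborel (indicator {a..b} :: real \<Rightarrow> real)"
  by (rule integrable_real_indicator) (auto simp: emeasure_lborel_Icc_eq)

lemma set_integrable_bounded_Icc:
  fixes h :: "real \<Rightarrow> real"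
  assumes "(\<lambda>x. indicator {a..b} x * h x) \<in> borel_measurable borel" "\<And>x. x \<in> {a..b} \<Longrightarrow> \<bar>h x\<bar> \<le> B"
  shows "set_integrable lborel {a..b} h"
  unfolding set_integrable_def
proof (rule Bochner_Integration.integrable_bound)
  show "integrable lborel (\<lambda>x. B * indicator {a..b} x)" using integrable_indicator_Icc by simp
  show "(\<lambda>x. indicator {a..b} x *\<^sub>R h x) \<in> borel_measurable lborel" using assms(1) by simp
  show "AE x in lborel. norm (indicator {a..b} x *\<^sub>R h x) \<le> norm (B * indicator {a..b} x)"
    using assms(2) by (intro AE_I2) (force simp: indicator_def)
qed

section \<open>Measurability, integrability and the tail error\<close>

context lipschitz_auction
begin

abbreviation samples :: "nat \<Rightarrow> (nat \<Rightarrow> real \<times> nat) measure" where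
  "samples n \<equiv> first_price_samples n k F"

lemma prob_space_outcome: "prob_space (first_price k F)"
  using two_le_k cdf by (intro prob_space_first_price) auto

lemma prob_space_samples: "prob_space (samples n)"
  unfolding first_price_samples_def using prob_space_outcome by (intro prob_space_PiM)

lemma sample_measurable:
  assumes "j < n"
  shows "(\<lambda>S. fst (S j)) \<in> borel_measurable (samples n)"
    and "(\<lambda>S. snd (S j)) \<in> measurable (samples n) (count_space UNIV)"
proof -
  have "(\<lambda>S. S j) \<in> measurable (samples n) (first_price k F)"
    unfolding first_price_samples_def using assms by (intro measurable_component_singleton) auto
  then have "(\<lambda>S. S j) \<in> measurable (samples n) (borel \<Otimes>\<^sub>M count_space UNIV)"
    using measurable_cong_sets[OF refl sets_first_price] by blast
  from measurable_compose[OF this measurable_fst] measurable_compose[OF this measurable_snd]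
  show "(\<lambda>S. fst (S j)) \<in> borel_measurable (samples n)"
    "(\<lambda>S. snd (S j)) \<in> measurable (samples n) (count_space UNIV)" by auto
qed

text \<open>Samples and evaluation point both depend on \<open>w\<close>, so that one lemma covers
  fixed points, points that are samples themselves, and the product of sample space and real
  line.\<close>

lemma rank_measurable:
  fixes M :: "'a measure"
  assumes [measurable]: "T \<in> measurable M (samples n)" "y \<in> borel_measurable M"
  shows "(\<lambda>w. real (rank n (T w) (y w))) \<in> borel_measurable M"
  unfolding rank_def of_nat_sum
proof (rule borel_measurable_sum)
  fix j assume "j \<in> {..<n}"
  then have [measurable]: "(\<lambda>w. fst (T w j)) \<in> borel_measurable M"
    using measurable_compose[OF assms(1) sample_measurable(1)[of j n]] by simp
  have "(\<lambda>w. if fst (T w j) \<le> y w then 1 else 0 :: real) \<in> borel_measurable M" by measurable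
  moreover have "real (of_bool P) = (if P then 1 else 0)" for P by simp
  ultimately show "(\<lambda>w. real (of_bool (fst (T w j) \<le> y w))) \<in> borel_measurable M" by simp
qed

lemma product_limit_measurable:
  fixes M :: "'a measure"
  assumes T [measurable]: "T \<in> measurable M (samples n)" and y [measurable]: "y \<in> borel_measurable M"
  shows "(\<lambda>w. product_limit n (T w) i (y w)) \<in> borel_measurable M"
  unfolding product_limit_def
proof (rule borel_measurable_prod)
  fix j assume j: "j \<in> {..<n}"
  then have Y [measurable]: "(\<lambda>w. fst (T w j)) \<in> borel_measurable M"
    and Z [measurable]: "(\<lambda>w. snd (T w j)) \<in> measurable M (count_space UNIV)"
    using measurable_compose[OF T sample_measurable(1)[of j n]]
      measurable_compose[OF T sample_measurable(2)[of j n]] by auto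
  have [measurable]: "(\<lambda>w. real (rank n (T w) (fst (T w j)))) \<in> borel_measurable M"
    by (rule rank_measurable) measurable
  show "(\<lambda>w. if snd (T w j) = i \<and> y w < fst (T w j) then 1 - 1 / real (rank n (T w) (fst (T w j))) else 1)
      \<in> borel_measurable M"
    by measurable
qed

lemma density_estimate_measurable:
  "(\<lambda>(S, x). density_estimate k L \<delta> n S i x) \<in> borel_measurable (samples n \<Otimes>\<^sub>M lborel)"
proof -
  define l where "l = real (window L \<delta> n)"
  let ?M = "samples n \<Otimes>\<^sub>M lborel"
  have T [measurable]: "fst \<in> measurable ?M (samples n)" and x [measurable]: "snd \<in> borel_measurable ?M"
    by simp_all
  have r [measurable]: "(\<lambda>w. real (rank n (fst w) (snd w))) \<in> borel_measurable ?M"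
    by (rule rank_measurable) measurable
  have [measurable]: "(\<lambda>w. product_limit n (fst w) i (snd w)) \<in> borel_measurable ?M"
    by (rule product_limit_measurable) measurable
  have [measurable]: "(\<lambda>w. product_limit n (fst w) i (snd w + l / real (rank n (fst w) (snd w)))) \<in> borel_measurable ?M"
    by (rule product_limit_measurable) measurable
  show ?thesis
    unfolding density_estimate_def Let_def l_def[symmetric] case_prod_beta by measurable
qed

lemma estimate_error_measurable:
  assumes i: "i \<in> {1..k}" and p: "0 \<le> p"
  shows "(\<lambda>(S, x). indicator {p..1} x * \<bar>density_estimate k L \<delta> n S i x - f i x\<bar>)
    \<in> borel_measurable (samples n \<Otimes>\<^sub>M lborel)"
proof -
  \<comment> \<open>Outside the unit interval \<open>f i\<close> is arbitrary and possibly not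
    measurable; since \<open>0 \<le> p\<close>, the indicator hides those values.\<close>
  have eq: "indicator {p..1} x * \<bar>g - f i x\<bar> = indicator {p..1} x * \<bar>g - f i x * indicator {0..1} x\<bar>" for g x
    using p by (auto simp: indicator_def)
  have "(\<lambda>w. f i (snd w) * indicator {0..1} (snd w)) \<in> borel_measurable (samples n \<Otimes>\<^sub>M lborel)"
    by (rule measurable_compose[OF _ f_measurable[OF i]]) simp
  moreover have "(\<lambda>w. density_estimate k L \<delta> n (fst w) i (snd w)) \<in> borel_measurable (samples n \<Otimes>\<^sub>M lborel)"
    using density_estimate_measurable by (simp add: case_prod_beta)
  moreover have "(\<lambda>w. indicator {p..1} (snd w) :: real) \<in> borel_measurable (samples n \<Otimes>\<^sub>M lborel)"
    by (rule measurable_compose[OF measurable_snd]) simp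
  ultimately show ?thesis unfolding case_prod_beta eq
    by (intro borel_measurable_times[OF _ borel_measurable_abs[OF borel_measurable_diff]])
qed

lemma estimate_error_integrable:
  assumes i: "i \<in> {1..k}" and p: "0 \<le> p" and S: "S \<in> space (samples n)"
  shows "set_integrable lborel {p..1} (\<lambda>x. \<bar>density_estimate k L \<delta> n S i x - f i x\<bar>)"
proof (rule set_integrable_bounded_Icc)
  show "(\<lambda>x. indicator {p..1} x * \<bar>density_estimate k L \<delta> n S i x - f i x\<bar>) \<in> borel_measurable borel"
    using measurable_Pair2[OF estimate_error_measurable[OF i p] S] by simp
  fix x assume "x \<in> {p..1}"
  then have "\<bar>f i x - 1\<bar> \<le> L" using p by (intro f_near_1[OF i]) auto
  then show "\<bar>\<bar>density_estimate k L \<delta> n S i x - f i x\<bar>\<bar> \<le> real n + 2 + L"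
    using density_estimate_bound[of k L \<delta> n S i x] by linarith
qed

text \<open>Integrability holds for every sample, so the event reduces to a bound on a parameter
  integral, measurable by Fubini. A nonmeasurable set would have measure 0, so the lower bound on
  the probability depends on this.\<close>

lemma tail_event_sets:
  assumes i: "i \<in> {1..k}" and p: "0 \<le> p"
  shows "{S \<in> space (samples n). tail_L1_close p \<epsilon> (density_estimate k L \<delta> n S i) (f i)} \<in> sets (samples n)"
proof -
  have "(\<lambda>S. LBINT x:{p..1}. \<bar>density_estimate k L \<delta> n S i x - f i x\<bar>) \<in> borel_measurable (samples n)"
    unfolding set_lebesgue_integral_def real_scaleR_def
    using estimate_error_measurable[OF i p] by (intro lborel.borel_measurable_lebesgue_integral)
  then have "{S \<in> space (samples n). (LBINT x:{p..1}. \<bar>density_estimate k L \<delta> n S i x - f i x\<bar>) \<le> \<epsilon>} \<in> sets (samples n)"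
    by measurable
  moreover have "{S \<in> space (samples n). tail_L1_close p \<epsilon> (density_estimate k L \<delta> n S i) (f i)} =
      {S \<in> space (samples n). (LBINT x:{p..1}. \<bar>density_estimate k L \<delta> n S i x - f i x\<bar>) \<le> \<epsilon>}"
    unfolding tail_L1_close_def using estimate_error_integrable[OF i p] by auto
  ultimately show ?thesis by simp
qed

lemma tail_close_if_pointwise:
  assumes i: "i \<in> {1..k}" and p: "0 \<le> p" and S: "S \<in> space (samples n)"
    and "0 \<le> c" "0 \<le> d" "c + L * d \<le> \<epsilon>"
    and close: "\<And>x. p \<le> x \<Longrightarrow> x \<le> 1 \<Longrightarrow>
      \<bar>density_estimate k L \<delta> n S i x - f i x\<bar> \<le> c + L * indicator {1 - d..1} x"
  shows "tail_L1_close p \<epsilon> (density_estimate k L \<delta> n S i) (f i)"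
proof -
  let ?e = "\<lambda>x. \<bar>density_estimate k L \<delta> n S i x - f i x\<bar>"
  note int = estimate_error_integrable[OF i p S, of \<delta>]
  have "(LBINT x:{p..1}. ?e x) \<le> (\<integral>x. c * indicator {0..1} x + L * indicator {1 - d..1} x \<partial>lborel)"
    unfolding set_lebesgue_integral_def
  proof (rule integral_mono)
    show "integrable lborel (\<lambda>x. indicator {p..1} x *\<^sub>R ?e x)" using int by (simp add: set_integrable_def)
    show "integrable lborel (\<lambda>x. c * indicator {0..1} x + L * indicator {1 - d..1} x)"
      using integrable_indicator_Icc by (intro Bochner_Integration.integrable_add integrable_mult_right) auto
    fix x
    show "indicator {p..1} x *\<^sub>R ?e x \<le> c * indicator {0..1} x + L * indicator {1 - d..1} x"
      using close[of x] p \<open>0 \<le> c\<close> L_pos by (auto simp: indicator_def split: if_splits)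
  qed
  also have "\<dots> = c + L * d" using \<open>0 \<le> d\<close> by simp
  finally show ?thesis using int \<open>c + L * d \<le> \<epsilon>\<close> by (simp add: tail_L1_close_def)
qed

lemma tail_close_constant:
  assumes i: "i \<in> {1..k}" and p: "0 \<le> p" and S: "S \<in> space (samples n)"
    and const: "\<And>x. p \<le> x \<Longrightarrow> x \<le> 1 \<Longrightarrow> density_estimate k L \<delta> n S i x = 1" and "L \<le> \<epsilon>"
  shows "tail_L1_close p \<epsilon> (density_estimate k L \<delta> n S i) (f i)"
proof (rule tail_close_if_pointwise[OF i p S, where c = L and d = 0])
  fix x assume x: "p \<le> x" "x \<le> 1"
  have "\<bar>1 - f i x\<bar> \<le> L" using f_near_1[OF i, of x] x p by (simp add: abs_minus_commute)
  moreover have "0 \<le> L * indicator {1 - 0..1} x" using L_pos by simp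
  ultimately show "\<bar>density_estimate k L \<delta> n S i x - f i x\<bar> \<le> L + L * indicator {1 - 0..1} x"
    using const[OF x] by linarith
qed (use L_pos \<open>L \<le> \<epsilon>\<close> in auto)

section \<open>Deviation events and the union bound\<close>

definition log_inverse :: "nat \<Rightarrow> real \<Rightarrow> real" where
  "log_inverse i x = - ln (F i x)"

text \<open>Apply \<open>ln t \<le> t - 1\<close> to the ratio of the values of \<open>F i\<close>,
  then \<open>F_ratio_le\<close>.\<close>

lemma log_inverse_diff:
  assumes i: "i \<in> {1..k}" and "x \<le> y" and pos: "0 < H x"
  shows "log_inverse i y \<le> log_inverse i x \<and> log_inverse i x - log_inverse i y \<le> H y / H x - 1"
proof -
  have Fx: "0 < F i x" using F_pos[OF i pos] .
  have Fy: "F i x \<le> F i y" using F_mono[OF i \<open>x \<le> y\<close>] .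
  have "ln (F i y) - ln (F i x) = ln (F i y / F i x)" using Fx Fy by (simp add: ln_div)
  also have "\<dots> \<le> F i y / F i x - 1" using Fx Fy by (intro ln_le_minus_one) auto
  finally have "ln (F i y) - ln (F i x) \<le> H y / H x - 1" using F_ratio_le[OF i \<open>x \<le> y\<close> pos] by linarith
  moreover have "ln (F i x) \<le> ln (F i y)" using Fx Fy by (intro ln_mono) auto
  ultimately show ?thesis by (simp add: log_inverse_def)
qed

text \<open>The case \<open>y = max x 1\<close> of the previous lemma, where both \<open>F i\<close>
  and \<open>H\<close> equal 1.\<close>

lemma log_inverse_bounds:
  assumes i: "i \<in> {1..k}" and pos: "0 < H x"
  shows "0 \<le> log_inverse i x \<and> log_inverse i x \<le> 1 / H x - 1"
  using log_inverse_diff[OF i _ pos, of "max x 1"] F_one[OF i, of "max x 1"] H_one[of "max x 1"]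
  by (simp add: log_inverse_def)

definition rank_bad :: "nat \<Rightarrow> real \<Rightarrow> real \<Rightarrow> (nat \<Rightarrow> real \<times> nat) set" where
  "rank_bad n \<alpha> y = {S \<in> space (samples n). \<alpha> \<le> \<bar>(\<Sum>j<n. of_bool (fst (S j) \<le> y)) / real n - H y\<bar>}"

definition hazard_bad :: "nat \<Rightarrow> nat \<Rightarrow> real \<Rightarrow> real \<Rightarrow> real \<Rightarrow> (nat \<Rightarrow> real \<times> nat) set" where
  "hazard_bad n i \<alpha> c y = {S \<in> space (samples n).
     \<alpha> \<le> \<bar>(\<Sum>j<n. c * (if snd (S j) = i \<and> y < fst (S j) then 1 / H (fst (S j)) else 0)) / real n
        - c * log_inverse i y\<bar>}"

lemma rank_bad_prob:
  assumes "0 < n" "0 \<le> \<alpha>"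
  shows "measure (samples n) (rank_bad n \<alpha> y) \<le> 2 * exp (- 2 * real n * \<alpha>\<^sup>2)"
proof -
  interpret outcome: prob_space "first_price k F" by (rule prob_space_outcome)
  have eq: "of_bool (fst w \<le> y) = indicator {w. fst w \<le> y} w" for w :: "real \<times> nat" by simp
  have "{w \<in> space (first_price k F). fst w \<le> y} \<in> sets (first_price k F)" by measurable
  then have sets: "{w. fst w \<le> y} \<in> sets (first_price k F)" by simp
  have "(\<lambda>w. of_bool (fst w \<le> y) :: real) \<in> borel_measurable (first_price k F)"
    unfolding eq using sets by simp
  from outcome.iid_mean_deviation[OF this _ _ assms]
  have "measure (samples n) {S \<in> space (samples n).
      \<alpha> \<le> \<bar>(\<Sum>j<n. of_bool (fst (S j) \<le> y)) / real n - outcome.expectation (\<lambda>w. of_bool (fst w \<le> y))\<bar>}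
    \<le> 2 * exp (- 2 * real n * \<alpha>\<^sup>2)"
    by (simp add: first_price_samples_def)
  moreover have "outcome.expectation (\<lambda>w. of_bool (fst w \<le> y)) = H y"
    unfolding eq using measure_highest_bid[of y] sets by simp
  ultimately show ?thesis by (simp add: rank_bad_def)
qed

text \<open>Since \<open>c \<le> H y\<close> and \<open>H\<close> is monotone, the weights
  \<open>c / H\<close> to the right of \<open>y\<close> are at most 1, as Hoeffding's inequality
  requires; the mean is supplied by \<open>integral_inverse_H\<close>.\<close>

lemma hazard_bad_prob:
  assumes i: "i \<in> {1..k}" and y: "y \<in> {0..1}" and c: "0 < c" "c \<le> H y" and "0 < n" "0 \<le> \<alpha>"
  shows "measure (samples n) (hazard_bad n i \<alpha> c y) \<le> 2 * exp (- 2 * real n * \<alpha>\<^sup>2)"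
proof -
  interpret outcome: prob_space "first_price k F" by (rule prob_space_outcome)
  define g :: "real \<times> nat \<Rightarrow> real" where
    "g = (\<lambda>w. c * (if snd w = i \<and> y < fst w then 1 / H (fst w) else 0))"
  have "g \<in> borel_measurable (borel \<Otimes>\<^sub>M count_space UNIV)" unfolding g_def by measurable
  then have meas: "g \<in> borel_measurable (first_price k F)"
    using measurable_cong_sets[OF sets_first_price refl] by blast
  have g: "0 \<le> g w" "g w \<le> 1" for w
    using c H_nonneg H_mono[of y "fst w"] by (auto simp: g_def divide_le_eq)
  have "outcome.expectation g = c * log_inverse i y"
    unfolding g_def using integral_inverse_H[OF i y] c by (simp add: log_inverse_def)
  with outcome.iid_mean_deviation[OF meas g assms(5,6)]
  have "measure (samples n) {S \<in> space (samples n). \<alpha> \<le> \<bar>(\<Sum>j<n. g (S j)) / real n - c * log_inverse i y\<bar>}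
      \<le> 2 * exp (- 2 * real n * \<alpha>\<^sup>2)"
    by (simp only: first_price_samples_def)
  then show ?thesis by (simp only: hazard_bad_def g_def)
qed

lemma rank_bad_sets: "rank_bad n \<alpha> y \<in> sets (samples n)"
proof -
  have "(\<lambda>S. real (rank n S y)) \<in> borel_measurable (samples n)"
    by (rule rank_measurable) auto
  then show ?thesis unfolding rank_bad_def rank_def of_nat_sum of_nat_of_bool by measurable
qed

lemma hazard_bad_sets: "hazard_bad n i \<alpha> c y \<in> sets (samples n)"
proof -
  have "(\<lambda>S. \<Sum>j<n. c * (if snd (S j) = i \<and> y < fst (S j) then 1 / H (fst (S j)) else 0)) \<in> borel_measurable (samples n)"
  proof (rule borel_measurable_sum)
    fix j assume "j \<in> {..<n}"
    then have [measurable]: "(\<lambda>S. fst (S j)) \<in> borel_measurable (samples n)"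
        "(\<lambda>S. snd (S j)) \<in> measurable (samples n) (count_space UNIV)"
      using sample_measurable[of j n] by auto
    show "(\<lambda>S. c * (if snd (S j) = i \<and> y < fst (S j) then 1 / H (fst (S j)) else 0)) \<in> borel_measurable (samples n)"
      by measurable
  qed
  then show ?thesis unfolding hazard_bad_def by measurable
qed

text \<open>Two events at each of \<open>n\<close> grid points, each of probability at most
  \<open>2 * exp (- 2 * n * \<alpha>^2)\<close>: this is the source of
  \<open>4 * n / \<delta>\<close> in \<open>log_bound\<close>. Only the fixed bidder
  \<open>i\<close> is involved, so there is no union over bidders.\<close>

lemma good_event:
  assumes i: "i \<in> {1..k}" and n: "0 < n" and \<alpha>: "0 \<le> \<alpha>"
    and small: "4 * real n * exp (- 2 * real n * \<alpha>\<^sup>2) \<le> \<delta>"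
    and q: "\<And>m. m \<in> {1..n} \<Longrightarrow> q m \<in> {0..1} \<and> H (q m) = real m / real n"
    and E: "E \<in> sets (samples n)"
    and good: "\<And>S. S \<in> space (samples n) \<Longrightarrow>
      (\<And>m. m \<in> {1..n} \<Longrightarrow> S \<notin> rank_bad n \<alpha> (q m) \<and> S \<notin> hazard_bad n i \<alpha> (real m / real n) (q m)) \<Longrightarrow> S \<in> E"
  shows "1 - \<delta> \<le> measure (samples n) E"
proof -
  interpret prob_space "samples n" by (rule prob_space_samples)
  define B where "B = (\<lambda>m. rank_bad n \<alpha> (q m) \<union> hazard_bad n i \<alpha> (real m / real n) (q m))"
  have B_sets: "B m \<in> sets (samples n)" for m
    unfolding B_def using rank_bad_sets hazard_bad_sets by auto
  have B_prob: "prob (B m) \<le> 4 * exp (- 2 * real n * \<alpha>\<^sup>2)" if m: "m \<in> {1..n}" for m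
  proof -
    have "prob (B m) \<le> prob (rank_bad n \<alpha> (q m)) + prob (hazard_bad n i \<alpha> (real m / real n) (q m))"
      unfolding B_def using rank_bad_sets hazard_bad_sets by (intro measure_Un_le)
    also have "\<dots> \<le> 2 * exp (- 2 * real n * \<alpha>\<^sup>2) + 2 * exp (- 2 * real n * \<alpha>\<^sup>2)"
      using q[OF m] m n by (intro add_mono rank_bad_prob[OF n \<alpha>] hazard_bad_prob[OF i _ _ _ n \<alpha>]) auto
    finally show ?thesis by simp
  qed
  have "prob (\<Union>m\<in>{1..n}. B m) \<le> (\<Sum>m\<in>{1..n}. prob (B m))"
    using B_sets by (intro finite_measure_subadditive_finite) auto
  also have "\<dots> \<le> (\<Sum>m\<in>{1..n}. 4 * exp (- 2 * real n * \<alpha>\<^sup>2))"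
    by (intro sum_mono B_prob)
  also have "\<dots> \<le> \<delta>" using small by simp
  finally have "1 - \<delta> \<le> 1 - prob (\<Union>m\<in>{1..n}. B m)" by simp
  also have "\<dots> = prob (space (samples n) - (\<Union>m\<in>{1..n}. B m))"
    using B_sets by (subst prob_compl) auto
  also have "\<dots> \<le> prob E"
    using good E by (intro finite_measure_mono) (auto simp: B_def)
  finally show ?thesis .
qed


text \<open>Either \<open>n\<close> is below the threshold, or the window was cut off at
  \<open>n\<close>, or the deviation analysis applies. In the first two cases the estimate is
  constantly 1 and \<open>L \<le> \<epsilon>\<close>.\<close>

theorem estimate_tail_close:
  assumes \<delta>: "0 < \<delta>" "\<delta> < 1" and p: "0 \<le> p" and \<gamma>: "\<gamma> \<le> H p" and \<epsilon>: "0 < \<epsilon>" "\<epsilon> \<le> \<gamma> / 2"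
    and \<phi>: "\<phi> = L\<^sup>2 * ln (real k / \<delta>) / (\<gamma> ^ 4 * \<epsilon> ^ 4)"
    and n: "10 ^ 20 * \<phi> * ln \<phi> \<le> real n" and i: "i \<in> {1..k}"
  shows "1 - \<delta> \<le> measure (samples n)
    {S \<in> space (samples n). tail_L1_close p \<epsilon> (density_estimate k L \<delta> n S i) (f i)}"
proof -
  interpret prob_space "samples n" by (rule prob_space_samples)
  define E where "E = {S \<in> space (samples n). tail_L1_close p \<epsilon> (density_estimate k L \<delta> n S i) (f i)}"
  have E_sets: "E \<in> sets (samples n)" unfolding E_def by (rule tail_event_sets[OF i p])
  \<comment> \<open>\<gamma> and \<epsilon> enter \<phi> only through this product, which is also
    the scale that \<open>L * b\<close> has to stay below.\<close>
  define v where "v = \<gamma> * \<epsilon>"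
  define \<Lambda> where "\<Lambda> = ln (real k / \<delta>)"
  have \<gamma>01: "0 < \<gamma>" "\<gamma> \<le> 1" using \<gamma> \<epsilon> H_le_1[of p] by auto
  have "\<gamma> * \<epsilon> \<le> 1 * (1 / 2)" using \<gamma>01 \<epsilon> by (intro mult_mono) auto
  then have v: "0 < v" "v \<le> 1 / 2" using \<gamma>01 \<epsilon> by (auto simp: v_def)
  have v\<epsilon>: "v \<le> \<epsilon>" "v \<le> \<gamma>" using \<gamma>01 \<epsilon> by (auto simp: v_def mult_le_cancel_right1 mult_le_cancel_left2)
  have "1 / \<delta> \<le> real k / \<delta>" using two_le_k \<delta> by (intro divide_right_mono) auto
  moreover have "2 * 1 \<le> real k * (1 / \<delta>)" using two_le_k \<delta> by (intro mult_mono) auto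
  ultimately have \<Lambda>: "ln (1 / \<delta>) \<le> \<Lambda>" "ln 2 \<le> \<Lambda>" unfolding \<Lambda>_def using \<delta> by (auto intro!: ln_mono)
  have \<phi>v: "\<phi> = L\<^sup>2 * \<Lambda> / v ^ 4" by (simp add: \<phi> v_def \<Lambda>_def power_mult_distrib)
  have const_case: ?thesis
    if "L \<le> \<epsilon>" and "\<And>S x. p \<le> x \<Longrightarrow> x \<le> 1 \<Longrightarrow> density_estimate k L \<delta> n S i x = 1"
  proof -
    have "E = space (samples n)" unfolding E_def using tail_close_constant[OF i p] that by auto
    then show ?thesis unfolding E_def[symmetric] using \<delta> by (simp add: prob_space)
  qed
  define l where "l = window L \<delta> n"
  define b where "b = real l / real n"
  consider "n < threshold" | "threshold \<le> n" "l = n" | "threshold \<le> n" "l \<noteq> n" by linarith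
  then show ?thesis
  proof cases
    case 1
    then show ?thesis
      using small_sample[OF 1 L_pos v \<Lambda>(2) \<phi>v n] v\<epsilon>
      by (intro const_case) (auto simp: density_estimate_def Let_def)
  next
    case 2
    have "0 < n" using 2 by (simp add: threshold_def)
    \<comment> \<open>Here \<open>b = 1\<close>, so \<open>window_small\<close> bounds
      \<open>L\<close> itself. The test in the estimate always fails, since no rank exceeds
      \<open>n\<close>.\<close>
    then have "L \<le> \<epsilon>"
      using window_small[OF 2(1) L_pos \<delta> v \<Lambda> \<phi>v n] 2(2) v\<epsilon> L_pos by (simp add: l_def)
    moreover have "density_estimate k L \<delta> n S i x = 1" if "p \<le> x" for S x
    proof -
      have "real (rank n S x) \<le> real n" using rank_le[of n S x] by simp
      moreover have "0 \<le> x * real (rank n S x)" using that p by simp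
      ultimately have "\<not> x * real (rank n S x) + real l < real (rank n S x)" using 2(2) by linarith
      then show ?thesis by (simp add: density_estimate_def Let_def l_def)
    qed
    ultimately show ?thesis by (intro const_case)
  next
    case 3
    \<comment> \<open>Chosen so that \<open>\<alpha> / b = L * b\<close>, which equates the orders
      of stochastic error and bias.\<close>
    define \<alpha> where "\<alpha> = L * b\<^sup>2"
    define m where "m = log_bound \<delta> n"
    have n20: "10 ^ 20 \<le> n" using 3(1) by (simp only: threshold_def)
    then have n0: "2 \<le> real n" "0 < n" by auto
    have b01: "0 \<le> b" "b \<le> 1" using window_le[of L \<delta> n] n0 by (auto simp: b_def l_def divide_le_eq)
    have Lb: "40 * (L * b) \<le> v" using window_small[OF 3(1) L_pos \<delta> v \<Lambda> \<phi>v n] by (simp add: b_def l_def)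
    have \<alpha>_le: "\<alpha> \<le> L * b" using b01 L_pos by (simp add: \<alpha>_def power2_eq_square mult_le_cancel_left2 mult_left_le)
    have \<alpha>0: "0 \<le> \<alpha>" using L_pos by (simp add: \<alpha>_def)
    have "l = n \<or> real m * real n ^ 3 \<le> 2 * L\<^sup>2 * real l ^ 4"
      unfolding l_def m_def window_def by (rule LeastI[of _ n]) simp
    then have "real m * real n ^ 3 \<le> 2 * L\<^sup>2 * real l ^ 4" using 3(2) by simp
    also have "\<dots> = 2 * L\<^sup>2 * (b * real n) ^ 4" using n0 by (simp add: b_def)
    also have "\<dots> = (2 * real n * \<alpha>\<^sup>2) * real n ^ 3"
      by (simp add: \<alpha>_def power2_eq_square power3_eq_cube power4_eq_xxxx)
    finally have m_le: "real m \<le> 2 * real n * \<alpha>\<^sup>2" using n0 by simp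
    \<comment> \<open>The logarithm was not cut off: otherwise \<open>\<alpha>^2\<close> would be at
      least 1/2, whereas \<open>\<alpha> \<le> L * b \<le> 1 / 80\<close>.\<close>
    have "m \<noteq> n"
    proof
      assume "m = n"
      then have "real n * 1 \<le> real n * (2 * \<alpha>\<^sup>2)" using m_le by simp
      then have "1 \<le> 2 * \<alpha>\<^sup>2" using n0 by (simp only: mult_le_cancel_left_pos)
      moreover have "\<alpha>\<^sup>2 \<le> (1 / 80)\<^sup>2" using \<alpha>0 \<alpha>_le Lb v by (intro power_mono) auto
      ultimately show False by (simp add: power2_eq_square)
    qed
    moreover have "m = n \<or> 4 * real n \<le> 2 ^ m * \<delta>"
      unfolding m_def log_bound_def by (rule LeastI[of _ n]) simp
    ultimately have pow: "4 * real n \<le> 2 ^ m * \<delta>" by simp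
    \<comment> \<open>Replacing base 2 by \<open>e\<close> converts the binary bound into the
      exponential that occurs in Hoeffding's inequality.\<close>
    have "(2::real) ^ m \<le> exp 1 ^ m" using exp_ge_add_one_self[of 1] by (intro power_mono) auto
    also have "\<dots> = exp (real m)" by (simp flip: exp_of_nat_mult)
    also have "\<dots> \<le> exp (2 * real n * \<alpha>\<^sup>2)" using m_le by simp
    finally have pow_exp: "2 ^ m \<le> exp (2 * real n * \<alpha>\<^sup>2)" .
    have "4 * real n \<le> exp (2 * real n * \<alpha>\<^sup>2) * \<delta>"
      using pow mult_right_mono[OF pow_exp, of \<delta>] \<delta> by linarith
    then have small: "4 * real n * exp (- 2 * real n * \<alpha>\<^sup>2) \<le> \<delta>"
      by (simp add: exp_minus divide_simps mult.commute)
    have inverse_n: "1 / real n \<le> \<alpha>"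
    proof (rule power2_le_imp_le[OF _ \<alpha>0])
      \<comment> \<open>For \<open>m = 0\<close> the choice of \<open>m\<close> would say
        \<open>4 * n \<le> \<delta>\<close>, which is below 1.\<close>
      have "1 \<le> real m"
      proof (rule ccontr)
        assume "\<not> 1 \<le> real m"
        then have "m = 0" by simp
        then show False using pow n0 \<delta> by simp
      qed
      then have "1 \<le> 2 * real n * \<alpha>\<^sup>2" using m_le by linarith
      also have "\<dots> \<le> real n * real n * \<alpha>\<^sup>2" using n0 by (intro mult_right_mono) auto
      finally show "(1 / real n)\<^sup>2 \<le> \<alpha>\<^sup>2" using n0 by (simp add: power_divide divide_le_eq power2_eq_square mult_ac)
    qed
    have \<alpha>_pos: "0 < \<alpha>" using inverse_n n0 by (meson less_le_trans of_nat_0_less_iff zero_less_divide_1_iff)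
    then have b0: "0 < b" using b01 by (cases "b = 0") (auto simp: \<alpha>_def)
    obtain q where q: "\<And>m. m \<in> {1..n} \<Longrightarrow> q m \<in> {0..1} \<and> H (q m) = real m / real n"
    proof -
      have "\<exists>y. y \<in> {0..1} \<and> H y = real m / real n" if "m \<in> {1..n}" for m
        using H_quantile[of "real m / real n"] that n0 by (metis atLeastAtMost_iff divide_le_eq_1_pos divide_nonneg_nonneg of_nat_0_le_iff of_nat_0_less_iff of_nat_le_iff)
      then show ?thesis using that by metis
    qed
    show ?thesis unfolding E_def[symmetric]
    proof (rule good_event[OF i n0(2) \<alpha>0 small q E_sets])
      fix S assume S: "S \<in> space (samples n)"
        and good: "\<And>m. m \<in> {1..n} \<Longrightarrow> S \<notin> rank_bad n \<alpha> (q m) \<and> S \<notin> hazard_bad n i \<alpha> (real m / real n) (q m)"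
      interpret D: deviation_bounds n i S H "log_inverse i" q \<alpha>
      proof
        show "H (q m) = real m / real n" if "m \<in> {1..n}" for m using q[OF that] by simp
        show "\<bar>real (rank n S (q m)) / real n - real m / real n\<bar> \<le> \<alpha>" if "m \<in> {1..n}" for m
          using good[OF that] S q[OF that] by (simp add: rank_bad_def rank_def of_nat_sum not_le less_imp_le del: sum_of_bool_eq)
        show "\<bar>(\<Sum>j<n. real m / real n * (if snd (S j) = i \<and> q m < fst (S j) then 1 / H (fst (S j)) else 0)) / real n
            - real m / real n * log_inverse i (q m)\<bar> \<le> \<alpha>" if "m \<in> {1..n}" for m
          using good[OF that] S unfolding hazard_bad_def by fastforce
      qed (use n0 inverse_n H_mono H_nonneg H_le_1 log_inverse_diff[OF i] log_inverse_bounds[OF i] in auto)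
      have F_dev: "\<bar>product_limit n S i y - F i y\<bar> \<le> 12 * \<alpha> / (H y)\<^sup>2" if "4 * \<alpha> \<le> H y" for y
        using D.product_limit_deviation[OF that] F_pos[OF i D.Hx_pos[OF that]] by (simp add: log_inverse_def)
      have pointwise: "\<bar>density_estimate k L \<delta> n S i x - f i x\<bar>
          \<le> 38 * (L * b) / \<gamma> + L * indicator {1 - 2 * b / \<gamma>..1} x" if x: "p \<le> x" "x \<le> 1" for x
      proof -
        define u where "u = H x"
        define r where "r = real (rank n S x)"
        have u: "\<gamma> \<le> u" "0 < u" "4 * \<alpha> \<le> u"
          using \<gamma> H_mono[OF x(1)] \<gamma>01 \<alpha>_le Lb v\<epsilon> L_pos b01 by (auto simp: u_def)
        have "\<bar>r / real n - u\<bar> \<le> 2 * \<alpha>" using D.rank_deviation[of x] by (simp add: r_def u_def)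
        \<comment> \<open>From \<open>4 * \<alpha> \<le> u\<close>: the rank deviation is at most
          \<open>u / 2\<close>. Hence the random step \<open>h\<close> agrees with
          \<open>b / u\<close> up to constants.\<close>
        then have "u / 2 \<le> r / real n" "r / real n \<le> 3 / 2 * u" using u by linarith+
        then have r: "u / 2 * real n \<le> r" "r \<le> 3 / 2 * u * real n" using n0 by (auto simp: field_simps)
        have r0: "0 < r" using r(1) u n0 by (smt (verit) half_gt_zero mult_pos_pos)
        define h where "h = real l / r"
        have h_eq: "h * r = b * real n" using r0 n0 by (simp add: h_def b_def)
        have h0: "0 < h" using h_eq b0 n0 r0 by (smt (verit) zero_less_mult_iff)
        have h_upper: "h * u \<le> 2 * b"
        proof -
          have "h * (u / 2 * real n) \<le> h * r" using r h0 by (intro mult_left_mono) auto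
          then show ?thesis using n0 unfolding h_eq by (simp add: field_simps)
        qed
        have h_lower: "2 * b \<le> 3 * (h * u)"
        proof -
          have "h * r \<le> h * (3 / 2 * u * real n)" using r h0 by (intro mult_left_mono) auto
          then show ?thesis using n0 unfolding h_eq by (simp add: field_simps)
        qed
        have hu: "h \<le> 2 * b / \<gamma>"
        proof -
          have "h \<le> 2 * b / u" using h_upper u by (simp add: field_simps)
          also have "\<dots> \<le> 2 * b / \<gamma>" using u \<gamma>01 b01 by (intro divide_left_mono) auto
          finally show ?thesis .
        qed
        have step: "x * r + real l < r \<longleftrightarrow> x + h < 1"
        proof -
          have "x * r + real l = (x + h) * r" using r0 by (simp add: h_def algebra_simps)
          then show ?thesis using r0 mult_less_cancel_right_pos[of r "x + h" 1] by simp
        qed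
        have x01: "x \<in> {0..1}" using x p by simp
        show ?thesis
        proof (cases "x + h < 1")
          case True
          define G where "G = product_limit n S i"
          have est: "density_estimate k L \<delta> n S i x = (G (x + h) - G x) / h"
            using True step 3(1) by (simp add: density_estimate_def Let_def G_def h_def r_def l_def)
          have u': "u \<le> H (x + h)" unfolding u_def using h0 by (intro H_mono) simp
          have "\<bar>G (x + h) - F i (x + h)\<bar> \<le> 12 * \<alpha> / (H (x + h))\<^sup>2"
            unfolding G_def using u u' by (intro F_dev) simp
          also have "\<dots> \<le> 12 * \<alpha> / u\<^sup>2"
            using u u' \<alpha>0 by (intro divide_left_mono power_mono) auto
          finally have "\<bar>G (x + h) - F i (x + h)\<bar> \<le> 12 * \<alpha> / u\<^sup>2" .
          moreover have "\<bar>G x - F i x\<bar> \<le> 12 * \<alpha> / u\<^sup>2"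
            using F_dev[of x] u by (simp add: G_def u_def)
          ultimately have "\<bar>(G (x + h) - G x) - (F i (x + h) - F i x)\<bar> \<le> 24 * \<alpha> / u\<^sup>2" by simp
          then have "\<bar>(G (x + h) - G x) - (F i (x + h) - F i x)\<bar> / h \<le> 24 * \<alpha> / u\<^sup>2 / h"
            using h0 by (intro divide_right_mono) auto
          then have stoch: "\<bar>(G (x + h) - G x) / h - (F i (x + h) - F i x) / h\<bar> \<le> 24 * \<alpha> / (u * (h * u))"
            using h0 by (simp add: abs_divide power2_eq_square mult_ac flip: diff_divide_distrib)
          \<comment> \<open>By the lower bound \<open>2 * b / 3\<close> for \<open>h * u\<close>,
            the noise is at most \<open>36 * \<alpha> / (u * b) = 36 * (L * b) / u\<close>. The bias
            \<open>L * h\<close> below adds 2 to make 38.\<close>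
          have "24 * \<alpha> / (u * (h * u)) \<le> 24 * \<alpha> / (u * (2 * b / 3))"
            using h_lower u b0 h0 \<alpha>0 by (intro divide_left_mono mult_left_mono mult_pos_pos) auto
          also have "\<dots> = 36 * (L * b) / u" using b0 u by (simp add: \<alpha>_def field_simps power2_eq_square)
          also have "\<dots> \<le> 36 * (L * b) / \<gamma>" using u \<gamma>01 b01 L_pos by (intro divide_left_mono) auto
          finally have "24 * \<alpha> / (u * (h * u)) \<le> 36 * (L * b / \<gamma>)" by simp
          moreover have "\<bar>(F i (x + h) - F i x) / h - f i x\<bar> \<le> L * h"
            using True x p h0 by (intro F_difference_quotient[OF i]) auto
          moreover have "L * h \<le> L * (2 * b / \<gamma>)" using hu L_pos by (intro mult_left_mono) auto
          then have "L * h \<le> 2 * (L * b / \<gamma>)" by (simp add: mult_ac)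
          moreover have "0 \<le> L * indicator {1 - 2 * b / \<gamma>..1} x" using L_pos by simp
          ultimately have "\<bar>(G (x + h) - G x) / h - f i x\<bar> \<le> 38 * (L * b / \<gamma>) + L * indicator {1 - 2 * b / \<gamma>..1} x"
            using stoch by linarith
          then show ?thesis unfolding est by simp
        next
          case False
          then have "density_estimate k L \<delta> n S i x = 1"
            using step by (simp add: density_estimate_def Let_def r_def l_def)
          \<comment> \<open>Failure of the test means \<open>x + h \<ge> 1\<close>, so
            \<open>x\<close> is within \<open>h \<le> 2 * b / \<gamma>\<close> of the right
            end.\<close>
          moreover have "x \<in> {1 - 2 * b / \<gamma>..1}" using False hu x by simp
          moreover have "\<bar>1 - f i x\<bar> \<le> L" using f_near_1[OF i x01] by (simp add: abs_minus_commute)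
          moreover have "0 \<le> 38 * (L * b) / \<gamma>" using L_pos b01 \<gamma>01 by simp
          ultimately show ?thesis by simp
        qed
      qed
      \<comment> \<open>The strip contributes its length \<open>2 * b / \<gamma>\<close> times
        \<open>L\<close>, which completes the constant 40 of \<open>window_small\<close>.\<close>
      have "38 * (L * b) / \<gamma> + L * (2 * b / \<gamma>) = 40 * (L * b) / \<gamma>" by (simp add: field_simps)
      also have "\<dots> \<le> v / \<gamma>" using Lb \<gamma>01 by (intro divide_right_mono) auto
      also have "\<dots> = \<epsilon>" using \<gamma>01 by (simp add: v_def)
      finally have "tail_L1_close p \<epsilon> (density_estimate k L \<delta> n S i) (f i)"
        using L_pos b01 \<gamma>01 pointwise
        by (intro tail_close_if_pointwise[OF i p S, where c = "38 * (L * b) / \<gamma>" and d = "2 * b / \<gamma>"]) auto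
      then show "S \<in> E" using S by (simp add: E_def)
    qed
  qed
qed

end

theorem theorem2p4:
  shows "\<exists>(alg :: com) (fhat :: estimator) (C :: real) (c :: nat).
    computes_in_poly_time alg fhat \<and> 0 < C \<and> 1 \<le> c \<and>
    (\<forall>(k :: nat) (F :: nat \<Rightarrow> real \<Rightarrow> real) (f :: nat \<Rightarrow> real \<Rightarrow> real) (L :: real) (\<delta> :: real) (n :: nat).
      2 \<le> k \<longrightarrow>
      (\<forall>i\<in>{1..k}. unit_cdf (F i) \<and> has_unit_density (F i) (f i)) \<longrightarrow>
      0 < L \<longrightarrow>
      (\<forall>i\<in>{1..k}. \<forall>x\<in>{0..1}. \<forall>y\<in>{0..1}. \<bar>f i x - f i y\<bar> \<le> L * \<bar>x - y\<bar>) \<longrightarrow>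
      0 < \<delta> \<longrightarrow> \<delta> < 1 \<longrightarrow>
      (\<forall>(p :: real) (\<gamma> :: real) (\<epsilon> :: real).
        0 \<le> p \<longrightarrow> 0 \<le> \<gamma> \<longrightarrow>
        \<gamma> \<le> measure (first_price k F) {(y, z). y \<le> p} \<longrightarrow>
        0 < \<epsilon> \<longrightarrow> \<epsilon> \<le> \<gamma> / 2 \<longrightarrow>
        (let \<phi> = L\<^sup>2 * ln (real k / \<delta>) / (\<gamma> ^ 4 * \<epsilon> ^ 4)
         in C * \<phi> * (ln \<phi>) ^ c \<le> real n) \<longrightarrow>
        (\<forall>i\<in>{1..k}.
          1 - \<delta> \<le> measure (first_price_samples n k F)
            {S \<in> space (first_price_samples n k F).
               tail_L1_close p \<epsilon> (\<lambda>x. fhat k L \<delta> n S i x) (f i)})))"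
\<comment> \<open>A single logarithm suffices, so \<open>c = 1\<close>; the value of
  \<open>C\<close> is the factor in the hypothesis of \<open>phi_ln_bound\<close> and is not
  optimised.\<close>
proof (intro exI[of _ estimate_prog] exI[of _ density_estimate] exI[of _ "10 ^ 20 :: real"] exI[of _ "1 :: nat"] conjI allI impI ballI)
  show "computes_in_poly_time estimate_prog density_estimate" by (rule estimate_prog_poly_time)
next
  fix k :: nat and F f :: "nat \<Rightarrow> real \<Rightarrow> real" and L \<delta> :: real and n :: nat and p \<gamma> \<epsilon> :: real and i :: nat
  assume "2 \<le> k" "\<forall>i\<in>{1..k}. unit_cdf (F i) \<and> has_unit_density (F i) (f i)" "0 < L"
    "\<forall>i\<in>{1..k}. \<forall>x\<in>{0..1}. \<forall>y\<in>{0..1}. \<bar>f i x - f i y\<bar> \<le> L * \<bar>x - y\<bar>"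
  then interpret lipschitz_auction k F f L by unfold_locales auto
  assume "0 < \<delta>" "\<delta> < 1" "0 \<le> p" "\<gamma> \<le> measure (first_price k F) {(y, z). y \<le> p}"
    "0 < \<epsilon>" "\<epsilon> \<le> \<gamma> / 2"
    "let \<phi> = L\<^sup>2 * ln (real k / \<delta>) / (\<gamma> ^ 4 * \<epsilon> ^ 4) in 10 ^ 20 * \<phi> * (ln \<phi>) ^ 1 \<le> real n" "i \<in> {1..k}"
  moreover have "{(y, z). y \<le> p} = {w :: real \<times> nat. fst w \<le> p}" by auto
  ultimately show "1 - \<delta> \<le> measure (first_price_samples n k F)
      {S \<in> space (first_price_samples n k F). tail_L1_close p \<epsilon> (\<lambda>x. density_estimate k L \<delta> n S i x) (f i)}"
    using measure_highest_bid[of p] by (intro estimate_tail_close) (auto simp: Let_def)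
qed simp_all

end
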